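(* Let $\kappa$ be a cardinal and assume $\mathbf{MA}_\kappa(\text{ccc and almost }\omega^\omega\text{-bounding})$. Then every atomless ccc forcing notion of size $\le\kappa$ adds a Cohen real.
   Context: A stronger condition is the greater one. A forcing notion $\mathbb{P}$ is almost $\omega^\omega$-bounding if for every $\mathbb{P}$-name $\dot f$ for an element of $\omega^\omega$ and every $p\in\mathbb{P}$ there is $g\in\omega^\omega\cap\mathbf{V}$ such that for every infinite $X\subseteq\omega$ with $X\in\mathbf{V}$ there is $p'\ge_{\mathbb{P}}p$ with $p'\Vdash_{\mathbb{P}}$ "there are infinitely many $n\in X$ with $\dot f(n)<g(n)$". For a forcing notion $\mathbb{P}$, $\mathbf{MA}_\kappa(\mathbb{P})$ states: for any maximal antichains $\mathcal{A}_\alpha\subseteq\mathbb{P}$ ($\alpha<\kappa$) and $p\in\mathbb{P}$ there is a filter $G\ni p$ on $\mathbb{P}$ meeting every $\mathcal{A}_\alpha$. $\mathbf{MA}_\kappa(\text{ccc and almost }\omega^\omega\text{-bounding})$ means $\mathbf{MA}_\kappa(\mathbb{P})$ holds for every ccc almost $\omega^\omega$-bounding forcing notion $\mathbb{P}$. *)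

theory Defs
  imports "HOL-Library.Countable_Set" "HOL-Library.Sublist"
begin

unbundle cardinal_syntax

section \<open>Forcing notions\<close>

text \<open>
  A forcing notion is a nonempty preorder, given by its order relation \<open>r\<close>; the set of conditions
  is \<open>Field r\<close>.  The stronger condition is the greater one: \<open>(p, q) \<in> r\<close> says that \<open>q\<close> is stronger
  than (or equivalent to) \<open>p\<close>.  A weakest condition is not required.
\<close>

definition forcing_notion :: "'p rel \<Rightarrow> bool" where
  "forcing_notion r \<longleftrightarrow> Preorder r \<and> Field r \<noteq> {}"

definition compatible :: "'p rel \<Rightarrow> 'p \<Rightarrow> 'p \<Rightarrow> bool" where
  "compatible r p q \<longleftrightarrow> (\<exists>s. (p, s) \<in> r \<and> (q, s) \<in> r)"

definition antichain :: "'p rel \<Rightarrow> 'p set \<Rightarrow> bool" where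
  "antichain r A \<longleftrightarrow> A \<subseteq> Field r \<and> (\<forall>p\<in>A. \<forall>q\<in>A. p \<noteq> q \<longrightarrow> \<not> compatible r p q)"

definition maximal_antichain :: "'p rel \<Rightarrow> 'p set \<Rightarrow> bool" where
  "maximal_antichain r A \<longleftrightarrow> antichain r A \<and> (\<forall>B. antichain r B \<and> A \<subseteq> B \<longrightarrow> B = A)"

definition ccc :: "'p rel \<Rightarrow> bool" where
  "ccc r \<longleftrightarrow> (\<forall>A. antichain r A \<longrightarrow> countable A)"

definition atomless :: "'p rel \<Rightarrow> bool" where
  "atomless r \<longleftrightarrow> (\<forall>p\<in>Field r. \<exists>q s. (p, q) \<in> r \<and> (p, s) \<in> r \<and> \<not> compatible r q s)"

definition forcing_filter :: "'p rel \<Rightarrow> 'p set \<Rightarrow> bool" where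
  "forcing_filter r G \<longleftrightarrow>
     G \<subseteq> Field r \<and> G \<noteq> {} \<and>
     (\<forall>p q. (p, q) \<in> r \<and> q \<in> G \<longrightarrow> p \<in> G) \<and>
     (\<forall>p\<in>G. \<forall>q\<in>G. \<exists>s\<in>G. (p, s) \<in> r \<and> (q, s) \<in> r)"


section \<open>The forcing relation\<close>

text \<open>
  The ground model \<open>V\<close> is the ambient universe of HOL.  A sentence of the forcing language is
  represented by its forcing relation, that is, by the conditions of each forcing notion which force
  it; the connectives below are the clauses of the usual recursive definition of forcing.
  Quantifiers range over (check names of) ground model sets \<open>X\<close>, which covers all the quantifiers
  over \<open>\<omega>\<close> and over finite sequences that are needed.

  \<open>f_meets S\<close> is the sentence ``\<open>S\<close> meets the generic filter''.
\<close>

type_synonym 'p sentence = "'p rel \<Rightarrow> 'p \<Rightarrow> bool"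

definition forces :: "'p rel \<Rightarrow> 'p \<Rightarrow> 'p sentence \<Rightarrow> bool" where
  "forces r p \<phi> \<longleftrightarrow> \<phi> r p"

definition f_meets :: "'p set \<Rightarrow> 'p sentence" where
  "f_meets S = (\<lambda>r p. \<forall>q. (p, q) \<in> r \<longrightarrow> (\<exists>s. (q, s) \<in> r \<and> (\<exists>a\<in>S. (a, s) \<in> r)))"

definition f_not :: "'p sentence \<Rightarrow> 'p sentence" where
  "f_not \<phi> = (\<lambda>r p. \<forall>q. (p, q) \<in> r \<longrightarrow> \<not> forces r q \<phi>)"

definition f_and :: "'p sentence \<Rightarrow> 'p sentence \<Rightarrow> 'p sentence" where
  "f_and \<phi> \<psi> = (\<lambda>r p. forces r p \<phi> \<and> forces r p \<psi>)"

definition f_all :: "'x set \<Rightarrow> ('x \<Rightarrow> 'p sentence) \<Rightarrow> 'p sentence" where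
  "f_all X \<phi> = (\<lambda>r p. \<forall>x\<in>X. forces r p (\<phi> x))"

definition f_ex :: "'x set \<Rightarrow> ('x \<Rightarrow> 'p sentence) \<Rightarrow> 'p sentence" where
  "f_ex X \<phi> = (\<lambda>r p. \<forall>q. (p, q) \<in> r \<longrightarrow> (\<exists>s. (q, s) \<in> r \<and> (\<exists>x\<in>X. forces r s (\<phi> x))))"


section \<open>Names for functions on \<open>\<omega>\<close>\<close>

text \<open>
  \<open>f :: nat \<Rightarrow> 'v \<Rightarrow> 'p set\<close> stands for the name \<open>{((n, v), a) | a \<in> f n v}\<close> (with check names for
  the pairs), whose interpretation by a generic filter \<open>G\<close> is \<open>{(n, v). f n v \<inter> G \<noteq> {}}\<close>.
  Every name forced to be a function from \<open>\<omega>\<close> to a ground model set is forced to be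
  equal to a name of this form.
\<close>

type_synonym ('p, 'v) fun_name = "nat \<Rightarrow> 'v \<Rightarrow> 'p set"

definition f_val :: "('p, 'v) fun_name \<Rightarrow> nat \<Rightarrow> 'v \<Rightarrow> 'p sentence" where
  "f_val f n v = f_meets (f n v)"

definition function_name :: "'p rel \<Rightarrow> ('p, 'v) fun_name \<Rightarrow> bool" where
  "function_name r f \<longleftrightarrow>
     (\<forall>n v. f n v \<subseteq> Field r) \<and>
     (\<forall>p\<in>Field r. forces r p
        (f_all UNIV (\<lambda>n. f_ex UNIV (\<lambda>v.
           f_and (f_val f n v) (f_all (- {v}) (\<lambda>w. f_not (f_val f n w)))))))"


section \<open>Almost \<open>\<omega>\<^sup>\<omega>\<close>-bounding forcing and Cohen reals\<close>

text \<open>The sentence ``there are infinitely many \<open>n \<in> X\<close> with \<open>f(n) < g(n)\<close>''.\<close>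

definition f_inf_often_below ::
  "('p, nat) fun_name \<Rightarrow> (nat \<Rightarrow> nat) \<Rightarrow> nat set \<Rightarrow> 'p sentence" where
  "f_inf_often_below f g X =
     f_all UNIV (\<lambda>m. f_ex {n\<in>X. m \<le> n} (\<lambda>n. f_ex {k. k < g n} (\<lambda>k. f_val f n k)))"

definition almost_bounding :: "'p rel \<Rightarrow> bool" where
  "almost_bounding r \<longleftrightarrow>
     (\<forall>(f :: ('p, nat) fun_name) p. function_name r f \<and> p \<in> Field r \<longrightarrow>
        (\<exists>g :: nat \<Rightarrow> nat. \<forall>X :: nat set. infinite X \<longrightarrow>
           (\<exists>p'. (p, p') \<in> r \<and> forces r p' (f_inf_often_below f g X))))"

text \<open>
  A real \<open>c \<in> 2\<^sup>\<omega>\<close> is Cohen over \<open>V\<close> if its initial segments form a generic filter of the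
  Cohen forcing \<open>2\<^sup><\<^sup>\<omega>\<close>, that is, if for every dense \<open>D \<subseteq> 2\<^sup><\<^sup>\<omega>\<close> in \<open>V\<close> some element of \<open>D\<close> is
  an initial segment of \<open>c\<close>.
\<close>

definition Cohen_dense :: "bool list set \<Rightarrow> bool" where
  "Cohen_dense D \<longleftrightarrow> (\<forall>s. \<exists>t\<in>D. prefix s t)"

definition f_Cohen :: "('p, bool) fun_name \<Rightarrow> 'p sentence" where
  "f_Cohen c =
     f_all {D. Cohen_dense D} (\<lambda>D. f_ex D (\<lambda>s. f_all {i. i < length s} (\<lambda>i. f_val c i (s ! i))))"

definition adds_Cohen_real :: "'p rel \<Rightarrow> bool" where
  "adds_Cohen_real r \<longleftrightarrow>
     (\<exists>c :: ('p, bool) fun_name. function_name r c \<and> (\<forall>p\<in>Field r. forces r p (f_Cohen c)))"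


section \<open>Martin's axiom\<close>

text \<open>A cardinal \<open>\<kappa>\<close> is a relation with \<open>Card_order \<kappa>\<close>; its elements are those of \<open>Field \<kappa>\<close>.\<close>

definition MA :: "'k rel \<Rightarrow> 'p rel \<Rightarrow> bool" where
  "MA \<kappa> r \<longleftrightarrow>
     (\<forall>\<A> :: 'k \<Rightarrow> 'p set. \<forall>p\<in>Field r.
        (\<forall>\<alpha>\<in>Field \<kappa>. maximal_antichain r (\<A> \<alpha>)) \<longrightarrow>
        (\<exists>G. forcing_filter r G \<and> p \<in> G \<and> (\<forall>\<alpha>\<in>Field \<kappa>. G \<inter> \<A> \<alpha> \<noteq> {})))"

text \<open>
  HOL cannot quantify over forcing notions of all types at once.  The type argument \<open>'u\<close> is the
  type of the conditions of the forcing notions considered.  For the axiom to have its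
  full strength it is enough that \<open>'u\<close> has at least \<open>\<kappa>\<^sup>\<omega>\<close> elements: a ccc almost
  \<open>\<omega>\<^sup>\<omega>\<close>-bounding forcing notion with \<open>\<kappa>\<close> maximal antichains (\<open>\<kappa>\<close> infinite; for finite \<open>\<kappa>\<close> the
  axiom is provable) has a suborder of size at most \<open>\<kappa>\<^sup>\<omega>\<close> containing a given condition and these
  antichains, in which the antichains are still maximal and which is again ccc and almost
  \<open>\<omega>\<^sup>\<omega>\<close>-bounding (intersect with a countably closed elementary submodel).
\<close>

definition MA_ccc_almost_bounding :: "'u itself \<Rightarrow> 'k rel \<Rightarrow> bool" where
  "MA_ccc_almost_bounding _ \<kappa> \<longleftrightarrow>
     (\<forall>r :: 'u rel. forcing_notion r \<and> ccc r \<and> almost_bounding r \<longrightarrow> MA \<kappa> r)"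

end

theory Submission
  imports Defs "HOL-Library.Countable_Set_Type"
begin

text \<open>
  Suppose first that below some condition \<open>P\<close> is \<open>\<omega>\<^sup>\<omega>\<close>-bounding; we may assume that it is so
  everywhere.  Then \<open>P\<close> is almost bounding, so Martin's axiom holds for \<open>P\<close>.  As \<open>|P| \<le> \<kappa>\<close>, this
  implies that the finite powers of \<open>P\<close> are ccc and bounding: an unbounded real in a product \<open>P \<times> Q\<close>
  is, after its first half is interpreted by a sufficiently generic filter in \<open>V\<close>, an unbounded
  real added by \<open>Q\<close>.  Hence the finite support power of \<open>P\<close> is ccc and almost bounding, and a generic
  filter for it shows \<open>P\<close> to be \<open>\<sigma>\<close>-centered with generic pieces.  But an atomless such forcing
  notion adds an unbounded real, a contradiction.  So \<open>P\<close> adds a function \<open>x\<close> that is unbounded below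
  every condition.  If \<open>h : \<omega> \<times> \<omega> \<rightarrow> 2\<^sup><\<^sup>\<omega>\<close> is generic enough for Cohen forcing, which is
  countable and so almost bounding, then \<open>h(0, x(0)) h(1, x(1)) \<dots>\<close> is a Cohen real: each condition
  leaves infinitely many values of some \<open>x(n)\<close> open over a fixed \<open>x|n\<close>, and \<open>h(n, \<cdot>)\<close> takes every
  value on this infinite set.
\<close>

section \<open>Dense and open sets of conditions\<close>

definition dense_above :: "'p rel \<Rightarrow> 'p \<Rightarrow> 'p set \<Rightarrow> bool" where
  "dense_above r p D \<longleftrightarrow> (\<forall>q. (p, q) \<in> r \<longrightarrow> (\<exists>s\<in>D. (q, s) \<in> r))"

definition open_in :: "'p rel \<Rightarrow> 'p set \<Rightarrow> bool" where
  "open_in r U \<longleftrightarrow> U \<subseteq> Field r \<and> (\<forall>p\<in>U. \<forall>q. (p, q) \<in> r \<longrightarrow> q \<in> U)"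

lemma forcing_notion_refl: "forcing_notion r \<Longrightarrow> p \<in> Field r \<Longrightarrow> (p, p) \<in> r"
  by (auto simp: forcing_notion_def preorder_on_def refl_on_def)

lemma forcing_notion_trans:
  "forcing_notion r \<Longrightarrow> (p, q) \<in> r \<Longrightarrow> (q, s) \<in> r \<Longrightarrow> (p, s) \<in> r"
  by (auto simp: forcing_notion_def preorder_on_def dest: transD)

lemma forcing_notionI:
  assumes "\<And>p. p \<in> Field r \<Longrightarrow> (p, p) \<in> r"
    and "\<And>p q s. (p, q) \<in> r \<Longrightarrow> (q, s) \<in> r \<Longrightarrow> (p, s) \<in> r"
    and "Field r \<noteq> {}"
  shows "forcing_notion r"
  using assms unfolding forcing_notion_def preorder_on_def
  by (auto intro!: refl_onI transI intro: FieldI1 FieldI2)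

lemma dense_aboveD: "dense_above r p D \<Longrightarrow> (p, q) \<in> r \<Longrightarrow> \<exists>s\<in>D. (q, s) \<in> r"
  by (simp add: dense_above_def)

lemma dense_above_mono: "dense_above r p D \<Longrightarrow> D \<subseteq> E \<Longrightarrow> dense_above r p E"
  unfolding dense_above_def by blast

lemma dense_above_trans:
  "forcing_notion r \<Longrightarrow> dense_above r p D \<Longrightarrow> (p, q) \<in> r \<Longrightarrow> dense_above r q D"
  unfolding dense_above_def by (meson forcing_notion_trans)

lemma open_inD: "open_in r U \<Longrightarrow> p \<in> U \<Longrightarrow> (p, q) \<in> r \<Longrightarrow> q \<in> U"
  by (auto simp: open_in_def)

section \<open>Compatibility and antichains\<close>

lemma compatible_sym: "compatible r p q \<Longrightarrow> compatible r q p"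
  by (auto simp: compatible_def)

lemma compatible_mono:
  assumes "forcing_notion r" "compatible r p q" "(p', p) \<in> r" "(q', q) \<in> r"
  shows "compatible r p' q'"
  using assms unfolding compatible_def by (meson forcing_notion_trans)

text \<open>Zorn's lemma is applied to the antichains lying inside \<open>D\<close>; an element of
  \<open>D\<close> incompatible with all of a maximal one could be added to it.\<close>

lemma antichain_in_set:
  assumes "forcing_notion r" "D \<subseteq> Field r"
  obtains A where "A \<subseteq> D" "antichain r A" "\<And>d. d \<in> D \<Longrightarrow> \<exists>a\<in>A. compatible r a d"
proof -
  let ?\<A> = "{A. A \<subseteq> D \<and> antichain r A}"
  have "\<exists>M\<in>?\<A>. \<forall>X\<in>?\<A>. M \<subseteq> X \<longrightarrow> X = M"
  proof (rule subset_Zorn')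
    fix C assume C: "subset.chain ?\<A> C"
    then have sub: "C \<subseteq> ?\<A>" and ch: "\<And>X Y. X \<in> C \<Longrightarrow> Y \<in> C \<Longrightarrow> X \<subseteq> Y \<or> Y \<subseteq> X"
      by (auto simp: subset_chain_def)
    have "antichain r (\<Union>C)"
      unfolding antichain_def
    proof (intro conjI ballI impI)
      show "\<Union>C \<subseteq> Field r" using sub assms(2) by blast
    next
      fix p q assume "p \<in> \<Union>C" "q \<in> \<Union>C" "p \<noteq> q"
      then obtain X where "X \<in> C" "p \<in> X" "q \<in> X" by (metis UnionE ch subsetD)
      then show "\<not> compatible r p q" using sub \<open>p \<noteq> q\<close> by (auto simp: antichain_def)
    qed
    then show "\<Union>C \<in> ?\<A>" using sub by blast
  qed
  then obtain A where A: "A \<subseteq> D" "antichain r A"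
    and max: "\<And>X. X \<subseteq> D \<Longrightarrow> antichain r X \<Longrightarrow> A \<subseteq> X \<Longrightarrow> X = A" by auto
  have "\<exists>a\<in>A. compatible r a d" if "d \<in> D" for d
  proof (rule ccontr)
    assume no: "\<not> ?thesis"
    have "antichain r (insert d A)"
      using A that no assms(2) unfolding antichain_def by (auto dest: compatible_sym)
    then have "d \<in> A" using max[of "insert d A"] A that by blast
    moreover have "(d, d) \<in> r" using forcing_notion_refl[OF assms(1)] assms(2) that by blast
    ultimately show False using no unfolding compatible_def by blast
  qed
  then show ?thesis using that A by blast
qed

text \<open>A condition incompatible with all of \<open>A\<close> would have an extension in
  \<open>D\<close> of the same kind. So for dense \<open>D\<close>, maximality inside
  \<open>D\<close> is maximality among all conditions.\<close>

lemma dense_contains_maximal_antichain: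
  assumes "forcing_notion r" "D \<subseteq> Field r" "\<And>p. p \<in> Field r \<Longrightarrow> \<exists>s\<in>D. (p, s) \<in> r"
  obtains A where "A \<subseteq> D" "maximal_antichain r A" "\<And>p. p \<in> Field r \<Longrightarrow> \<exists>a\<in>A. compatible r a p"
proof -
  obtain A where A: "A \<subseteq> D" "antichain r A" "\<And>d. d \<in> D \<Longrightarrow> \<exists>a\<in>A. compatible r a d"
    by (rule antichain_in_set[OF assms(1,2)]) blast
  have *: "\<exists>a\<in>A. compatible r a p" if p: "p \<in> Field r" for p
  proof -
    obtain s where s: "s \<in> D" "(p, s) \<in> r" using assms(3) p by blast
    obtain a where a: "a \<in> A" "compatible r a s" using A(3) s by blast
    have "(a, a) \<in> r" using a A assms by (meson forcing_notion_refl subsetD)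
    then show ?thesis using compatible_mono[OF assms(1) a(2) _ s(2)] a by blast
  qed
  have "maximal_antichain r A"
    unfolding maximal_antichain_def
  proof (intro conjI allI impI A(2))
    fix B assume B: "antichain r B \<and> A \<subseteq> B"
    show "B = A"
    proof
      show "B \<subseteq> A"
      proof
        fix b assume b: "b \<in> B"
        then have "b \<in> Field r" using B by (auto simp: antichain_def)
        then obtain a where "a \<in> A" "compatible r a b" using * by blast
        moreover have "a \<in> B" using B \<open>a \<in> A\<close> by blast
        ultimately show "b \<in> A" using B b unfolding antichain_def by metis
      qed
    qed (use B in blast)
  qed
  then show ?thesis using that A * by blast
qed

section \<open>Filters, and Martin's axiom for dense sets\<close>

lemma ccc_countable: "ccc r \<Longrightarrow> antichain r A \<Longrightarrow> countable A"
  by (simp add: ccc_def)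

lemma filter_directed:
  "forcing_filter r G \<Longrightarrow> p \<in> G \<Longrightarrow> q \<in> G \<Longrightarrow> \<exists>s\<in>G. (p, s) \<in> r \<and> (q, s) \<in> r"
  by (auto simp: forcing_filter_def)

lemma filter_down: "forcing_filter r G \<Longrightarrow> q \<in> G \<Longrightarrow> (p, q) \<in> r \<Longrightarrow> p \<in> G"
  unfolding forcing_filter_def by blast

lemma filter_Field: "forcing_filter r G \<Longrightarrow> p \<in> G \<Longrightarrow> p \<in> Field r"
  unfolding forcing_filter_def by blast

text \<open>The form in which the axiom is applied to dense sets later: they only have to be dense
  above \<open>p\<close>. Each is completed by the conditions incompatible with \<open>p\<close> and
  refined to a maximal antichain; a filter containing \<open>p\<close> avoids the added
  conditions.\<close>

lemma MA_dense:
  fixes \<kappa> :: "'k rel" and r :: "'p rel" and D :: "'i \<Rightarrow> 'p set"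
  assumes "MA \<kappa> r" "forcing_notion r" "Card_order \<kappa>" "|I| \<le>o \<kappa>" "p \<in> Field r"
    and sub: "\<And>i. i \<in> I \<Longrightarrow> D i \<subseteq> Field r"
    and dense: "\<And>i. i \<in> I \<Longrightarrow> dense_above r p (D i)"
  obtains G where "forcing_filter r G" "p \<in> G" "\<And>i. i \<in> I \<Longrightarrow> G \<inter> D i \<noteq> {}"
proof -
  have "|I| \<le>o |Field \<kappa>|"
    using assms(3,4) card_of_Field_ordIso ordIso_symmetric ordLeq_ordIso_trans by blast
  then obtain e where e: "inj_on e I" "e ` I \<subseteq> Field \<kappa>"
    using card_of_ordLeq by metis
  define E where "E i = D i \<union> {q \<in> Field r. \<not> compatible r p q}" for i
  have "\<exists>A. A \<subseteq> E i \<and> maximal_antichain r A" if i: "i \<in> I" for i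
  proof (rule dense_contains_maximal_antichain[OF assms(2), of "E i"])
    show "E i \<subseteq> Field r" using sub i by (auto simp: E_def)
    fix q assume q: "q \<in> Field r"
    show "\<exists>s\<in>E i. (q, s) \<in> r"
    proof (cases "compatible r p q")
      case True
      then obtain s where s: "(p, s) \<in> r" "(q, s) \<in> r" by (auto simp: compatible_def)
      then obtain t where "t \<in> D i" "(s, t) \<in> r" using dense_aboveD[OF dense[OF i]] by blast
      then show ?thesis using s forcing_notion_trans[OF assms(2)] by (auto simp: E_def)
    next
      case False
      then show ?thesis using q forcing_notion_refl[OF assms(2)] by (auto simp: E_def)
    qed
  qed blast
  then obtain A where A: "\<And>i. i \<in> I \<Longrightarrow> A i \<subseteq> E i \<and> maximal_antichain r (A i)" by metis
  obtain A0 where A0: "maximal_antichain r A0"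
    by (rule dense_contains_maximal_antichain[OF assms(2) subset_refl])
      (use forcing_notion_refl[OF assms(2)] in blast)+
  \<comment> \<open>The axiom asks for an antichain at every index in \<open>Field \<kappa>\<close>;
    \<open>A0\<close> fills the indices outside the range of \<open>e\<close>.\<close>
  define \<A> where "\<A> \<alpha> = (if \<alpha> \<in> e ` I then A (the_inv_into I e \<alpha>) else A0)" for \<alpha>
  have \<A>: "\<A> (e i) = A i" if "i \<in> I" for i
    using that e by (auto simp: \<A>_def the_inv_into_f_f)
  have "maximal_antichain r (\<A> \<alpha>)" for \<alpha>
  proof (cases "\<alpha> \<in> e ` I")
    case True
    then show ?thesis using A \<A> by auto
  next
    case False
    then show ?thesis using A0 by (simp add: \<A>_def)
  qed
  then obtain G where G: "forcing_filter r G" "p \<in> G" "\<forall>\<alpha>\<in>Field \<kappa>. G \<inter> \<A> \<alpha> \<noteq> {}"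
    using assms(1)[unfolded MA_def, rule_format, OF assms(5), of \<A>] by auto
  have "G \<inter> D i \<noteq> {}" if i: "i \<in> I" for i
  proof -
    have "G \<inter> A i \<noteq> {}" using G(3) \<A>[OF i] e i by (metis image_subset_iff)
    then obtain q where q: "q \<in> G" "q \<in> E i" using A i by blast
    moreover have "compatible r p q"
      using filter_directed[OF G(1) G(2) q(1)] by (auto simp: compatible_def)
    ultimately show ?thesis by (auto simp: E_def)
  qed
  then show ?thesis using that G by blast
qed

section \<open>Bounding properties\<close>

text \<open>
  A system \<open>b\<close> is a name for a sequence of nonempty subsets of \<open>\<omega>\<close>: \<open>b n v\<close> consists of the
  conditions putting \<open>v\<close> into the \<open>n\<close>-th set.
\<close>

definition total_system :: "'p rel \<Rightarrow> 'p \<Rightarrow> (nat \<Rightarrow> nat \<Rightarrow> 'p set) \<Rightarrow> bool" where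
  "total_system r p b \<longleftrightarrow> (\<forall>n v. open_in r (b n v)) \<and> (\<forall>n. dense_above r p (\<Union>v. b n v))"

text \<open>Localized at \<open>p\<close> because of the negation: it provides one system, total
  above \<open>p\<close>, that no function bounds above any extension of \<open>p\<close>.\<close>

definition bounding_at :: "'p rel \<Rightarrow> 'p \<Rightarrow> bool" where
  "bounding_at r p \<longleftrightarrow> (\<forall>b. total_system r p b \<longrightarrow>
     (\<exists>q g. (p, q) \<in> r \<and> (\<forall>n. dense_above r q (\<Union>v\<le>g n. b n v))))"

definition bounding :: "'p rel \<Rightarrow> bool" where
  "bounding r \<longleftrightarrow> (\<forall>p\<in>Field r. bounding_at r p)"

text \<open>In contrast to \<open>almost_bounding\<close>, one condition \<open>q\<close> serves all
  infinite sets \<open>X\<close>, and systems replace names, so that the property can be verified by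
  density arguments outside the forcing language.\<close>

definition strongly_almost_bounding :: "'p rel \<Rightarrow> bool" where
  "strongly_almost_bounding r \<longleftrightarrow> (\<forall>p\<in>Field r. \<forall>b. total_system r p b \<longrightarrow>
     (\<exists>q g. (p, q) \<in> r \<and> (\<forall>s X N. (q, s) \<in> r \<and> infinite X \<longrightarrow>
        (\<exists>k\<in>X. N \<le> k \<and> (\<exists>v<g k. \<exists>t\<in>b k v. (s, t) \<in> r)))))"

lemma boundingE:
  assumes "bounding r" "p \<in> Field r" "total_system r p b"
  obtains q g where "(p, q) \<in> r" "\<And>n. dense_above r q (\<Union>v\<le>g n. b n v)"
  using assms(1)[unfolded bounding_def bounding_at_def, rule_format, OF assms(2,3)] by auto

lemma strongly_almost_boundingE:
  assumes "strongly_almost_bounding r" "p \<in> Field r" "total_system r p b"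
  obtains q g where "(p, q) \<in> r"
    "\<And>s X N. (q, s) \<in> r \<Longrightarrow> infinite X \<Longrightarrow> \<exists>k\<in>X. N \<le> k \<and> (\<exists>v<g k. \<exists>t\<in>b k v. (s, t) \<in> r)"
proof -
  obtain q g where *: "(p, q) \<in> r" "\<forall>s X N. (q, s) \<in> r \<and> infinite X \<longrightarrow>
        (\<exists>k\<in>X. N \<le> k \<and> (\<exists>v<g k. \<exists>t\<in>b k v. (s, t) \<in> r))"
    using assms(1)[unfolded strongly_almost_bounding_def, rule_format, OF assms(2,3)]
    by (elim exE conjE)
  show ?thesis by (rule that[of q g]) (simp_all add: *)
qed

lemma total_systemD:
  assumes "total_system r p b"
  shows "open_in r (b n v)" "(p, q) \<in> r \<Longrightarrow> \<exists>v. \<exists>s\<in>b n v. (q, s) \<in> r"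
  using assms unfolding total_system_def dense_above_def by blast+

lemma strongly_almost_bounding_imp:
  fixes r :: "'p rel"
  assumes r: "forcing_notion r" and ab: "strongly_almost_bounding r"
  shows "almost_bounding r"
  unfolding almost_bounding_def
proof (intro allI impI)
  fix f :: "('p, nat) fun_name" and p assume *: "function_name r f \<and> p \<in> Field r"
  note [simp] = forces_def f_all_def f_ex_def f_and_def f_val_def f_not_def
  \<comment> \<open>The conditions forcing \<open>f(n) = v\<close>.\<close>
  define b where "b n v = {q \<in> Field r. f_meets (f n v) r q}" for n v
  have "total_system r p b"
    unfolding total_system_def
  proof (intro conjI allI)
    fix n v show "open_in r (b n v)"
      unfolding open_in_def b_def f_meets_def
      using forcing_notion_trans[OF r] by (auto intro: FieldI2)
  next
    fix n show "dense_above r p (\<Union>v. b n v)"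
      unfolding dense_above_def
    proof (intro allI impI)
      fix q assume q: "(p, q) \<in> r"
      have "\<forall>q. (p, q) \<in> r \<longrightarrow> (\<exists>s. (q, s) \<in> r \<and> (\<exists>v. f_meets (f n v) r s))"
        using * unfolding function_name_def by fastforce
      then obtain s v where "(q, s) \<in> r" "f_meets (f n v) r s" using q by blast
      then show "\<exists>s\<in>\<Union>v. b n v. (q, s) \<in> r" unfolding b_def by (auto intro: FieldI2)
    qed
  qed
  then obtain q g where q: "(p, q) \<in> r"
    and g: "\<And>s X N. (q, s) \<in> r \<Longrightarrow> infinite X \<Longrightarrow> \<exists>k\<in>X. N \<le> k \<and> (\<exists>v<g k. \<exists>t\<in>b k v. (s, t) \<in> r)"
    by (rule strongly_almost_boundingE[OF ab conjunct2[OF *]]) blast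
  show "\<exists>g. \<forall>X. infinite X \<longrightarrow> (\<exists>p'. (p, p') \<in> r \<and> forces r p' (f_inf_often_below f g X))"
  proof (intro exI[of _ g] allI impI exI[of _ q] conjI q)
    fix X :: "nat set" assume X: "infinite X"
    have "\<exists>t. (s, t) \<in> r \<and> (\<exists>n. n \<in> X \<and> m \<le> n \<and> (\<forall>t'. (t, t') \<in> r \<longrightarrow>
        (\<exists>u. (t', u) \<in> r \<and> (\<exists>v<g n. f_meets (f n v) r u))))" if s: "(q, s) \<in> r" for s m
    proof -
      obtain k v t where kv: "k \<in> X" "m \<le> k" "v < g k" "t \<in> b k v" "(s, t) \<in> r"
        using g[OF s X] by meson
      have "\<exists>u. (t', u) \<in> r \<and> (\<exists>v<g k. f_meets (f k v) r u)" if t': "(t, t') \<in> r" for t'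
      proof -
        have "(t', t') \<in> r" using t' r by (meson FieldI2 forcing_notion_refl)
        moreover have "f_meets (f k v) r t'"
          using kv(4) t' forcing_notion_trans[OF r] unfolding b_def f_meets_def by blast
        ultimately show ?thesis using kv(3) by blast
      qed
      then show ?thesis using kv by blast
    qed
    then show "forces r q (f_inf_often_below f g X)"
      unfolding f_inf_often_below_def by simp
  qed
qed

lemma bounding_imp_strongly_almost_bounding:
  assumes r: "forcing_notion r" and "bounding r"
  shows "strongly_almost_bounding r"
  unfolding strongly_almost_bounding_def
proof (intro ballI allI impI)
  fix p b assume "p \<in> Field r" "total_system r p b"
  then obtain q g where q: "(p, q) \<in> r" and g: "\<And>n. dense_above r q (\<Union>v\<le>g n. b n v)"
    by (rule boundingE[OF assms(2)]) blast
  show "\<exists>q g. (p, q) \<in> r \<and> (\<forall>s X N. (q, s) \<in> r \<and> infinite X \<longrightarrow>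
        (\<exists>k\<in>X. N \<le> k \<and> (\<exists>v<g k. \<exists>t\<in>b k v. (s, t) \<in> r)))"
  proof (intro exI[of _ q] exI[of _ "\<lambda>n. Suc (g n)"] conjI q allI impI; (elim conjE)?)
    fix s and X :: "nat set" and N assume s: "(q, s) \<in> r" and "infinite X"
    then obtain k where k: "k \<in> X" "N \<le> k" by (meson infinite_nat_iff_unbounded_le)
    have "\<exists>t\<in>(\<Union>v\<le>g k. b k v). (s, t) \<in> r" using dense_aboveD[OF g s] .
    then show "\<exists>k\<in>X. N \<le> k \<and> (\<exists>v<Suc (g k). \<exists>t\<in>b k v. (s, t) \<in> r)"
      using k by (auto simp: less_Suc_eq_le)
  qed
qed

section \<open>Countable families of bounds\<close>

lemma dominate_countable:
  fixes g :: "nat \<Rightarrow> nat \<Rightarrow> nat"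
  obtains h where "\<And>m k. m \<le> k \<Longrightarrow> g m k < h k"
proof
  fix m k :: nat assume "m \<le> k"
  then have "g m k \<le> Max ((\<lambda>m. g m k) ` {..k})" by (intro Max_ge) auto
  then show "g m k < Suc (Max ((\<lambda>m. g m k) ` {..k}))" by simp
qed

text \<open>Each condition \<open>s\<close> may choose its own bound \<open>g m\<close> and starting
  point \<open>k0\<close>, as long as the bounds form a countable family: a function
  \<open>h\<close> eventually above every \<open>g m\<close> then works with \<open>q = p\<close>,
  since an infinite \<open>X\<close> has elements beyond all the starting points involved.\<close>

lemma strongly_almost_boundingI:
  assumes r: "forcing_notion r"
    and *: "\<And>p b. p \<in> Field r \<Longrightarrow> total_system r p b \<Longrightarrow>
      \<exists>g :: nat \<Rightarrow> nat \<Rightarrow> nat. \<forall>s. (p, s) \<in> r \<longrightarrow>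
        (\<exists>m k0. \<forall>k\<ge>k0. \<exists>v\<le>g m k. \<exists>t\<in>b k v. (s, t) \<in> r)"
  shows "strongly_almost_bounding r"
  unfolding strongly_almost_bounding_def
proof (intro ballI allI impI)
  fix p b assume p: "p \<in> Field r" "total_system r p b"
  obtain g :: "nat \<Rightarrow> nat \<Rightarrow> nat" where g: "\<forall>s. (p, s) \<in> r \<longrightarrow>
        (\<exists>m k0. \<forall>k\<ge>k0. \<exists>v\<le>g m k. \<exists>t\<in>b k v. (s, t) \<in> r)"
    using *[OF p] by (elim exE)
  obtain h :: "nat \<Rightarrow> nat" where h: "\<And>m k. m \<le> k \<Longrightarrow> g m k < h k" by (rule dominate_countable[of g]) blast
  show "\<exists>q h. (p, q) \<in> r \<and> (\<forall>s X N. (q, s) \<in> r \<and> infinite X \<longrightarrow>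
        (\<exists>k\<in>X. N \<le> k \<and> (\<exists>v<h k. \<exists>t\<in>b k v. (s, t) \<in> r)))"
  proof (intro exI[of _ p] exI[of _ h] conjI allI impI; (elim conjE)?)
    show "(p, p) \<in> r" using forcing_notion_refl[OF r p(1)] .
    fix s and X :: "nat set" and N assume s: "(p, s) \<in> r" and "infinite X"
    obtain m k0 where mk: "\<forall>k\<ge>k0. \<exists>v\<le>g m k. \<exists>t\<in>b k v. (s, t) \<in> r"
      using g[rule_format, OF s] by (elim exE)
    obtain k where k: "k \<in> X" "max N (max m k0) \<le> k"
      using \<open>infinite X\<close> by (meson infinite_nat_iff_unbounded_le)
    then obtain v t where "v \<le> g m k" "t \<in> b k v" "(s, t) \<in> r" using mk[rule_format, of k] by auto
    then show "\<exists>k\<in>X. N \<le> k \<and> (\<exists>v<h k. \<exists>t\<in>b k v. (s, t) \<in> r)"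
      using k h[of m k] by (meson le_less_trans max.bounded_iff)
  qed
qed

text \<open>Each condition \<open>s\<close> leaves some value \<open>f s k\<close> possible at every
  \<open>k\<close>. These functions, one for each of the countably many conditions, are the required
  family of bounds.\<close>

lemma countable_strongly_almost_bounding:
  assumes r: "forcing_notion r" and "countable (Field r)"
  shows "strongly_almost_bounding r"
proof (rule strongly_almost_boundingI[OF r])
  fix p b assume p: "p \<in> Field r" "total_system r p b"
  have "\<exists>v. \<exists>t\<in>b k v. (s, t) \<in> r" if "(p, s) \<in> r" for s k
    using total_systemD(2)[OF p(2) that] .
  then obtain f where f: "\<And>s k. (p, s) \<in> r \<Longrightarrow> \<exists>t\<in>b k (f s k). (s, t) \<in> r" by metis
  show "\<exists>g :: nat \<Rightarrow> nat \<Rightarrow> nat. \<forall>s. (p, s) \<in> r \<longrightarrow>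
        (\<exists>m k0. \<forall>k\<ge>k0. \<exists>v\<le>g m k. \<exists>t\<in>b k v. (s, t) \<in> r)"
  proof (intro exI[of _ "\<lambda>m. f (from_nat_into (Field r) m)"] allI impI)
    fix s assume s: "(p, s) \<in> r"
    then obtain m where "from_nat_into (Field r) m = s"
      using assms(2) by (meson FieldI2 from_nat_into_surj)
    then show "\<exists>m k0. \<forall>k\<ge>k0. \<exists>v\<le>f (from_nat_into (Field r) m) k. \<exists>t\<in>b k v. (s, t) \<in> r"
      using f[OF s] by (metis order_refl)
  qed
qed

section \<open>Transfer of Martin's axiom between types\<close>

lemma dir_imageI: "(a, b) \<in> r \<Longrightarrow> (f a, f b) \<in> dir_image r f"
  by (auto simp: dir_image_def)

lemma dir_image_iff:
  assumes "inj_on f (Field r)" "a \<in> Field r" "b \<in> Field r"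
  shows "(f a, f b) \<in> dir_image r f \<longleftrightarrow> (a, b) \<in> r"
  using assms unfolding dir_image_def by (auto dest: inj_onD intro: FieldI1 FieldI2)

lemma forcing_notion_dir_image:
  assumes "forcing_notion r" "inj_on f (Field r)"
  shows "forcing_notion (dir_image r f)"
  using assms Preorder_dir_image[of r f] by (auto simp: forcing_notion_def dir_image_Field)

lemma compatible_dir_image:
  assumes "inj_on f (Field r)" "a \<in> Field r" "b \<in> Field r"
  shows "compatible (dir_image r f) (f a) (f b) \<longleftrightarrow> compatible r a b"
proof
  assume "compatible (dir_image r f) (f a) (f b)"
  then obtain s where "(f a, s) \<in> dir_image r f" "(f b, s) \<in> dir_image r f"
    by (auto simp: compatible_def)
  moreover from this have "s \<in> f ` Field r" by (metis FieldI2 dir_image_Field)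
  ultimately show "compatible r a b"
    using assms dir_image_iff[OF assms(1)] unfolding compatible_def by (metis imageE)
next
  assume "compatible r a b"
  then show "compatible (dir_image r f) (f a) (f b)"
    unfolding compatible_def by (meson dir_imageI)
qed

lemma antichain_dir_image:
  assumes "inj_on f (Field r)" "A \<subseteq> Field r"
  shows "antichain (dir_image r f) (f ` A) \<longleftrightarrow> antichain r A"
proof -
  have "compatible (dir_image r f) (f p) (f q) \<longleftrightarrow> compatible r p q" "f p = f q \<longleftrightarrow> p = q"
    if "p \<in> A" "q \<in> A" for p q
    using that assms compatible_dir_image[OF assms(1)] by (blast, meson inj_onD subsetD)
  then show ?thesis using assms(2) by (auto simp: antichain_def dir_image_Field)
qed

lemma ccc_dir_image:
  assumes "ccc r" "inj_on f (Field r)"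
  shows "ccc (dir_image r f)"
  unfolding ccc_def
proof (intro allI impI)
  fix B assume B: "antichain (dir_image r f) B"
  then obtain A where A: "A \<subseteq> Field r" "B = f ` A"
    by (auto simp: antichain_def dir_image_Field subset_image_iff)
  then show "countable B" using B assms antichain_dir_image ccc_countable by blast
qed

lemma strongly_almost_bounding_dir_image:
  assumes ab: "strongly_almost_bounding r" and f: "inj_on f (Field r)"
  shows "strongly_almost_bounding (dir_image r f)"
  unfolding strongly_almost_bounding_def
proof (intro ballI allI impI)
  let ?r = "dir_image r f"
  fix p' b' assume p': "p' \<in> Field ?r" and b': "total_system ?r p' b'"
  then obtain p where p: "p \<in> Field r" "p' = f p" by (auto simp: dir_image_Field)
  have ex: "\<exists>s. s' = f s \<and> (x, s) \<in> r" if "(f x, s') \<in> ?r" "x \<in> Field r" for s' x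
  proof -
    from that have "s' \<in> f ` Field r" by (metis FieldI2 dir_image_Field)
    then show ?thesis using that dir_image_iff[OF f] by blast
  qed
  define b where "b n v = {x \<in> Field r. f x \<in> b' n v}" for n v
  have "total_system r p b"
    unfolding total_system_def
  proof (intro conjI allI)
    fix n v show "open_in r (b n v)"
      using total_systemD(1)[OF b', of n v] dir_imageI[of _ _ r f]
      unfolding open_in_def b_def by (blast intro: FieldI2)
  next
    fix n show "dense_above r p (\<Union>v. b n v)"
      unfolding dense_above_def
    proof (intro allI impI)
      fix q assume q: "(p, q) \<in> r"
      then have "(p', f q) \<in> ?r" using p dir_image_iff[OF f] by (auto intro: FieldI2)
      then obtain v s' where "s' \<in> b' n v" "(f q, s') \<in> ?r" using total_systemD(2)[OF b'] by blast
      then show "\<exists>s\<in>\<Union>v. b n v. (q, s) \<in> r"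
        using ex[of q s'] q unfolding b_def by (auto intro: FieldI2)
    qed
  qed
  then obtain q g where q: "(p, q) \<in> r"
    and g: "\<And>s X N. (q, s) \<in> r \<Longrightarrow> infinite X \<Longrightarrow> \<exists>k\<in>X. N \<le> k \<and> (\<exists>v<g k. \<exists>t\<in>b k v. (s, t) \<in> r)"
    by (rule strongly_almost_boundingE[OF ab p(1)]) blast
  have qF: "q \<in> Field r" using q by (rule FieldI2)
  show "\<exists>q g. (p', q) \<in> ?r \<and> (\<forall>s X N. (q, s) \<in> ?r \<and> infinite X \<longrightarrow>
        (\<exists>k\<in>X. N \<le> k \<and> (\<exists>v<g k. \<exists>t\<in>b' k v. (s, t) \<in> ?r)))"
  proof (intro exI[of _ "f q"] exI[of _ g] conjI allI impI; (elim conjE)?)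
    show "(p', f q) \<in> ?r" using p q qF dir_image_iff[OF f] by blast
    fix s' and X :: "nat set" and N assume "(f q, s') \<in> ?r" and X: "infinite X"
    then obtain s where s: "s' = f s" "(q, s) \<in> r" using ex qF by blast
    then obtain k v t where "k \<in> X" "N \<le> k" "v < g k" "t \<in> b k v" "(s, t) \<in> r"
      using g[OF s(2) X] by meson
    then show "\<exists>k\<in>X. N \<le> k \<and> (\<exists>v<g k. \<exists>t\<in>b' k v. (s', t) \<in> ?r)"
      using s dir_image_iff[OF f] unfolding b_def by (metis (mono_tags, lifting) FieldI1 mem_Collect_eq)
  qed
qed

lemma forcing_filter_vimage:
  assumes G: "forcing_filter (dir_image r f) G" and f: "inj_on f (Field r)"
  shows "forcing_filter r {x \<in> Field r. f x \<in> G}"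
proof -
  have sub: "G \<subseteq> f ` Field r" using G by (auto simp: forcing_filter_def dir_image_Field)
  show ?thesis
    unfolding forcing_filter_def
  proof (intro conjI allI ballI impI)
    show "{x \<in> Field r. f x \<in> G} \<noteq> {}" using G sub by (auto simp: forcing_filter_def)
  next
    fix p q assume "(p, q) \<in> r \<and> q \<in> {x \<in> Field r. f x \<in> G}"
    then show "p \<in> {x \<in> Field r. f x \<in> G}"
      using filter_down[OF G] dir_imageI[of p q r f] by (auto intro: FieldI1)
  next
    fix p q assume p: "p \<in> {x \<in> Field r. f x \<in> G}" and q: "q \<in> {x \<in> Field r. f x \<in> G}"
    then obtain s' where s': "s' \<in> G" "(f p, s') \<in> dir_image r f" "(f q, s') \<in> dir_image r f"
      using filter_directed[OF G] by blast
    then obtain s where "s' = f s" "s \<in> Field r" using sub by blast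
    then show "\<exists>s\<in>{x \<in> Field r. f x \<in> G}. (p, s) \<in> r \<and> (q, s) \<in> r"
      using s' p q dir_image_iff[OF f] by auto
  qed blast
qed

text \<open>The axiom speaks of conditions of type \<open>'u\<close> only. An injection of
  \<open>Field r\<close> into \<open>'u\<close> carries the order over, together with its chain
  condition and bounding property, and the filter obtained for the copy is pulled back.\<close>

lemma MA_transfer:
  fixes \<kappa> :: "'k rel" and r :: "'q rel"
  assumes MA: "MA_ccc_almost_bounding TYPE('u) \<kappa>"
    and card: "|Field r| \<le>o |UNIV :: 'u set|"
    and r: "forcing_notion r" "ccc r" "strongly_almost_bounding r"
  shows "MA \<kappa> r"
proof -
  obtain f :: "'q \<Rightarrow> 'u" where f: "inj_on f (Field r)"
    using card card_of_ordLeq[of "Field r" "UNIV :: 'u set"] by blast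
  let ?r = "dir_image r f"
  have fn: "forcing_notion ?r" using forcing_notion_dir_image r f by blast
  have "MA \<kappa> ?r"
    using MA fn ccc_dir_image[OF r(2) f] strongly_almost_bounding_dir_image[OF r(3) f]
      strongly_almost_bounding_imp unfolding MA_ccc_almost_bounding_def by blast
  show ?thesis
    unfolding MA_def
  proof (intro allI ballI impI)
    fix \<A> :: "'k \<Rightarrow> 'q set" and p assume p: "p \<in> Field r"
      and \<A>: "\<forall>\<alpha>\<in>Field \<kappa>. maximal_antichain r (\<A> \<alpha>)"
    have "maximal_antichain ?r (f ` \<A> \<alpha>)" if "\<alpha> \<in> Field \<kappa>" for \<alpha>
      unfolding maximal_antichain_def
    proof (intro conjI allI impI)
      have a: "antichain r (\<A> \<alpha>)" and max: "\<And>B. antichain r B \<Longrightarrow> \<A> \<alpha> \<subseteq> B \<Longrightarrow> B = \<A> \<alpha>"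
        using \<A> that by (auto simp: maximal_antichain_def)
      then have sub: "\<A> \<alpha> \<subseteq> Field r" by (auto simp: antichain_def)
      show "antichain ?r (f ` \<A> \<alpha>)" using antichain_dir_image[OF f sub] a by blast
      fix C assume C: "antichain ?r C \<and> f ` \<A> \<alpha> \<subseteq> C"
      then obtain B where B: "B \<subseteq> Field r" "C = f ` B"
        by (auto simp: antichain_def dir_image_Field subset_image_iff)
      have "\<A> \<alpha> \<subseteq> B" using C B sub inj_on_image_mem_iff[OF f _ B(1)] by blast
      then show "C = f ` \<A> \<alpha>" using max B C antichain_dir_image[OF f B(1)] by blast
    qed
    moreover have "f p \<in> Field ?r" using p by (simp add: dir_image_Field)
    ultimately obtain G where G: "forcing_filter ?r G" "f p \<in> G"
      "\<forall>\<alpha>\<in>Field \<kappa>. G \<inter> f ` \<A> \<alpha> \<noteq> {}"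
      using \<open>MA \<kappa> ?r\<close>[unfolded MA_def, rule_format, of "f p" "\<lambda>\<alpha>. f ` \<A> \<alpha>"] by auto
    have sub: "\<A> \<alpha> \<subseteq> Field r" if "\<alpha> \<in> Field \<kappa>" for \<alpha>
      using \<A> that by (auto simp: maximal_antichain_def antichain_def)
    show "\<exists>G. forcing_filter r G \<and> p \<in> G \<and> (\<forall>\<alpha>\<in>Field \<kappa>. G \<inter> \<A> \<alpha> \<noteq> {})"
    proof (intro exI[of _ "{x \<in> Field r. f x \<in> G}"] conjI ballI)
      show "forcing_filter r {x \<in> Field r. f x \<in> G}" by (rule forcing_filter_vimage[OF G(1) f])
      show "p \<in> {x \<in> Field r. f x \<in> G}" using p G(2) by simp
      fix \<alpha> assume \<alpha>: "\<alpha> \<in> Field \<kappa>"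
      obtain x where "x \<in> \<A> \<alpha>" "f x \<in> G" using G(3) \<alpha> by blast
      then show "{x \<in> Field r. f x \<in> G} \<inter> \<A> \<alpha> \<noteq> {}" using sub[OF \<alpha>] by blast
    qed
  qed
qed

section \<open>Products\<close>

text \<open>The product of \<open>P\<close> and \<open>Q\<close>. Pairs are written as lists so that
  all finite powers of \<open>P\<close> live in the one type \<open>'p list\<close> and fit into a
  single finite support power.\<close>

definition cons_rel :: "'p rel \<Rightarrow> 'p list rel \<Rightarrow> 'p list rel" where
  "cons_rel P Q = {(p # ps, q # qs) | p ps q qs. (p, q) \<in> P \<and> (ps, qs) \<in> Q}"

lemma cons_rel_iff [simp]: "(p # ps, q # qs) \<in> cons_rel P Q \<longleftrightarrow> (p, q) \<in> P \<and> (ps, qs) \<in> Q"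
  by (simp add: cons_rel_def)

lemma cons_relE:
  assumes "(x, y) \<in> cons_rel P Q"
  obtains p ps q qs where "x = p # ps" "y = q # qs" "(p, q) \<in> P" "(ps, qs) \<in> Q"
  using assms by (auto simp: cons_rel_def)

lemma Field_cons_rel:
  assumes "forcing_notion P" "forcing_notion Q"
  shows "Field (cons_rel P Q) = (\<lambda>(p, ps). p # ps) ` (Field P \<times> Field Q)"
proof
  show "Field (cons_rel P Q) \<subseteq> (\<lambda>(p, ps). p # ps) ` (Field P \<times> Field Q)"
    by (auto simp: Field_def Domain_iff Range_iff elim!: cons_relE)
  show "(\<lambda>(p, ps). p # ps) ` (Field P \<times> Field Q) \<subseteq> Field (cons_rel P Q)"
  proof clarify
    fix p ps assume "p \<in> Field P" "ps \<in> Field Q"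
    then have "(p # ps, p # ps) \<in> cons_rel P Q" using forcing_notion_refl[OF assms(1)] forcing_notion_refl[OF assms(2)] by simp
    then show "p # ps \<in> Field (cons_rel P Q)" by (rule FieldI1)
  qed
qed

lemma Cons_in_Field_cons_rel [simp]:
  assumes "forcing_notion P" "forcing_notion Q"
  shows "p # ps \<in> Field (cons_rel P Q) \<longleftrightarrow> p \<in> Field P \<and> ps \<in> Field Q"
  by (auto simp: Field_cons_rel[OF assms])

lemma forcing_notion_cons_rel:
  assumes P: "forcing_notion P" and Q: "forcing_notion Q"
  shows "forcing_notion (cons_rel P Q)"
proof (rule forcing_notionI)
  fix x assume "x \<in> Field (cons_rel P Q)"
  then show "(x, x) \<in> cons_rel P Q"
    using forcing_notion_refl[OF P] forcing_notion_refl[OF Q] by (auto simp: Field_cons_rel[OF P Q])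
next
  fix x y z assume "(x, y) \<in> cons_rel P Q" "(y, z) \<in> cons_rel P Q"
  then show "(x, z) \<in> cons_rel P Q"
    by (auto elim!: cons_relE intro: forcing_notion_trans[OF P] forcing_notion_trans[OF Q])
next
  show "Field (cons_rel P Q) \<noteq> {}"
    using P Q by (auto simp: Field_cons_rel[OF P Q] forcing_notion_def)
qed

lemma card_Field_cons_rel:
  assumes "forcing_notion P" "forcing_notion Q" "Card_order \<kappa>" "infinite (Field \<kappa>)"
    and "|Field P| \<le>o \<kappa>" "|Field Q| \<le>o \<kappa>"
  shows "|Field (cons_rel P Q)| \<le>o \<kappa>"
  unfolding Field_cons_rel[OF assms(1,2)]
  by (rule ordLeq_transitive[OF card_of_image card_of_Times_ordLeq_infinite_Field[OF assms(4,5,6,3)]])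

text \<open>\<open>cardSuc natLeq\<close> is the first uncountable cardinal. \<open>W'\<close> is a
  copy of it inside \<open>W\<close>, and \<open>S w\<close> consists of the elements up to
  \<open>w\<close>; countable subsets are bounded because the cardinal is regular
  (\<open>cardSuc_UNION\<close>).\<close>

lemma uncountable_filtration:
  assumes "uncountable W"
  obtains W' S where "W' \<subseteq> W" "uncountable W'" "\<And>w. w \<in> W' \<Longrightarrow> countable (S w)"
    "\<And>B. B \<subseteq> W' \<Longrightarrow> countable B \<Longrightarrow> \<exists>w\<in>W'. B \<subseteq> S w"
proof -
  let ?o = "cardSuc natLeq"
  have co: "Card_order ?o" by (simp add: cardSuc_Card_order natLeq_Card_order)
  have wo: "Well_order ?o" using co card_order_on_well_order_on by blast
  have "natLeq <o |W|"
    using assms not_ordLeq_iff_ordLess[OF natLeq_Well_order card_of_Well_order]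
    by (auto simp: countable_card_le_natLeq)
  then have "?o \<le>o |W|"
    using cardSuc_ordLess_ordLeq[OF natLeq_Card_order card_of_Card_order] by blast
  then have "|Field ?o| \<le>o |W|"
    using card_of_Field_ordIso[OF co] ordIso_ordLeq_trans by blast
  then obtain f where f: "inj_on f (Field ?o)" "f ` Field ?o \<subseteq> W"
    using card_of_ordLeq[of "Field ?o" W] by blast
  define S where "S w = f ` under ?o (the_inv_into (Field ?o) f w)" for w
  have S: "S (f i) = f ` under ?o i" if "i \<in> Field ?o" for i
    using that f(1) by (simp add: S_def the_inv_into_f_f)
  have cnt: "countable (under ?o i)" if i: "i \<in> Field ?o" for i
  proof -
    have "|underS ?o i| <o ?o" using card_of_underS[OF co i] .
    then have "|underS ?o i| \<le>o natLeq"
      using cardSuc_ordLeq_ordLess[OF natLeq_Card_order card_of_Card_order] by blast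
    then have "countable (underS ?o i)" by (simp add: countable_card_le_natLeq)
    moreover have "under ?o i \<subseteq> insert i (underS ?o i)" by (auto simp: under_def underS_def)
    ultimately show ?thesis by (meson countable_insert countable_subset)
  qed
  have unc: "uncountable (f ` Field ?o)"
  proof
    assume "countable (f ` Field ?o)"
    then have "countable (Field ?o)" using f(1) by (simp add: countable_image_inj_eq)
    then have "|Field ?o| \<le>o natLeq" by (simp add: countable_card_le_natLeq)
    then have "?o \<le>o natLeq"
      by (rule ordIso_ordLeq_trans[OF ordIso_symmetric[OF card_of_Field_ordIso[OF co]]])
    then show False
      using not_ordLess_ordLeq[OF cardSuc_greater[OF natLeq_Card_order]] by blast
  qed
  have "\<exists>w\<in>f ` Field ?o. B \<subseteq> S w" if B: "B \<subseteq> f ` Field ?o" "countable B" for B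
  proof -
    have "\<exists>i\<in>Field ?o. B \<subseteq> f ` under ?o i"
    proof (rule cardSuc_UNION[of natLeq])
      show "relChain ?o (\<lambda>i. f ` under ?o i)"
        unfolding relChain_def
        using wo by (auto simp: under_def order_on_defs dest: transD)
      show "B \<subseteq> (\<Union>i\<in>Field ?o. f ` under ?o i)"
      proof
        fix x assume "x \<in> B"
        then obtain i where "i \<in> Field ?o" "x = f i" using B by blast
        moreover from this have "(i, i) \<in> ?o" using wo by (auto simp: order_on_defs refl_on_def)
        ultimately show "x \<in> (\<Union>i\<in>Field ?o. f ` under ?o i)" by (auto simp: under_def)
      qed
    qed (use B in \<open>auto simp: natLeq_card_order Field_natLeq countable_card_le_natLeq\<close>)
    then show ?thesis using S by auto
  qed
  moreover have "countable (S w)" if "w \<in> f ` Field ?o" for w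
    using that cnt S by auto
  ultimately show ?thesis by (intro that[of "f ` Field ?o" S] f(2) unc)
qed

text \<open>Given an uncountable antichain of the product, Martin's axiom for \<open>P\<close>
  provides a filter \<open>G\<close> containing the heads of uncountably many of its elements. Heads
  in \<open>G\<close> are compatible, so the corresponding tails form an uncountable antichain of
  \<open>Q\<close>.\<close>

lemma ccc_cons_rel:
  assumes \<kappa>: "Card_order \<kappa>" and MA: "MA \<kappa> P"
    and P: "forcing_notion P" "ccc P" and Q: "forcing_notion Q" "ccc Q"
    and card: "|Field (cons_rel P Q)| \<le>o \<kappa>"
  shows "ccc (cons_rel P Q)"
  unfolding ccc_def
proof (intro allI impI, rule ccontr)
  let ?R = "cons_rel P Q"
  fix W assume W: "antichain ?R W" and "uncountable W"
  then obtain W' S where W': "W' \<subseteq> W" "uncountable W'" and S: "\<And>w. w \<in> W' \<Longrightarrow> countable (S w)"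
    and cof: "\<And>B. B \<subseteq> W' \<Longrightarrow> countable B \<Longrightarrow> \<exists>w\<in>W'. B \<subseteq> S w"
    using uncountable_filtration by blast
  have sub: "W' \<subseteq> Field ?R" using W W' by (auto simp: antichain_def)
  have Cons: "hd w \<in> Field P" "tl w \<in> Field Q" "w = hd w # tl w" if "w \<in> W'" for w
    using that sub by (auto simp: Field_cons_rel[OF P(1) Q(1)])
  \<comment> \<open>A thin condition forces that all heads in the generic filter come from the
    countable part \<open>S w\<close> of \<open>W'\<close>.\<close>
  define thin where
    "thin = {p \<in> Field P. \<exists>w\<in>W'. \<forall>w'\<in>W' - S w. \<not> compatible P p (hd w')}"
  \<comment> \<open>If the thin conditions were dense, they would contain a countable maximal
    antichain, and the corresponding sets \<open>S (w a)\<close> would cover only countably many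
    elements. The head of any other element of \<open>W'\<close> would be incompatible with the
    whole antichain.\<close>
  have "\<exists>p\<in>Field P. \<forall>q. (p, q) \<in> P \<longrightarrow> q \<notin> thin"
  proof (rule ccontr)
    assume no: "\<not> ?thesis"
    obtain A where A: "A \<subseteq> thin" "maximal_antichain P A"
      "\<And>p. p \<in> Field P \<Longrightarrow> \<exists>a\<in>A. compatible P a p"
    proof (rule dense_contains_maximal_antichain[OF P(1), of thin])
      show "thin \<subseteq> Field P" by (auto simp: thin_def)
      show "\<exists>s\<in>thin. (q, s) \<in> P" if "q \<in> Field P" for q using no that by blast
    qed blast
    have "countable A" using A(2) P(2) by (simp add: maximal_antichain_def ccc_countable)
    have "\<forall>a\<in>A. \<exists>w. w \<in> W' \<and> (\<forall>w'\<in>W' - S w. \<not> compatible P a (hd w'))"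
      using A(1) by (auto simp: thin_def)
    then obtain w where "\<forall>a\<in>A. w a \<in> W' \<and> (\<forall>w'\<in>W' - S (w a). \<not> compatible P a (hd w'))"
      by (rule bchoice[THEN exE])
    then have w: "\<And>a. a \<in> A \<Longrightarrow> w a \<in> W'"
      "\<And>a w'. a \<in> A \<Longrightarrow> w' \<in> W' - S (w a) \<Longrightarrow> \<not> compatible P a (hd w')"
      by simp_all
    have "countable (\<Union>a\<in>A. S (w a))" using \<open>countable A\<close> S w(1) by auto
    then obtain w' where w': "w' \<in> W'" "w' \<notin> (\<Union>a\<in>A. S (w a))"
      using W'(2) by (meson countable_subset subsetI)
    obtain a where "a \<in> A" "compatible P a (hd w')" using A(3) Cons(1)[OF w'(1)] by blast
    then show False using w(2)[of a w'] w' by blast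
  qed
  then obtain p where p: "p \<in> Field P" "\<And>q. (p, q) \<in> P \<Longrightarrow> q \<notin> thin" by blast
  \<comment> \<open>Meeting \<open>D w\<close> puts the head of an element outside
    \<open>S w\<close> into the filter. Every countable subset of \<open>W'\<close> lies in some
    \<open>S w\<close>, so meeting all these sets leaves uncountably many heads in the
    filter.\<close>
  define D where "D w = {q. \<exists>w'\<in>W' - S w. (hd w', q) \<in> P}" for w
  have dense: "dense_above P p (D w)" if w: "w \<in> W'" for w
    unfolding dense_above_def
  proof (intro allI impI)
    fix q assume q: "(p, q) \<in> P"
    then have "q \<in> Field P" by (rule FieldI2)
    then obtain w' where "w' \<in> W' - S w" "compatible P q (hd w')"
      using p(2)[OF q] w by (auto simp: thin_def)
    then show "\<exists>s\<in>D w. (q, s) \<in> P" unfolding D_def compatible_def by blast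
  qed
  have "|W'| \<le>o \<kappa>" using card_of_mono1[OF sub] card ordLeq_transitive by blast
  then obtain G where G: "forcing_filter P G" "\<And>w. w \<in> W' \<Longrightarrow> G \<inter> D w \<noteq> {}"
    by (rule MA_dense[OF MA P(1) \<kappa> _ p(1), of W' D])
      (use dense in \<open>auto simp: D_def intro: FieldI2\<close>)
  define B where "B = {w \<in> W'. hd w \<in> G}"
  have unc: "uncountable B"
  proof
    assume "countable B"
    then obtain w where w: "w \<in> W'" "B \<subseteq> S w" using cof[of B] by (auto simp: B_def)
    then obtain q w' where "q \<in> G" "w' \<in> W' - S w" "(hd w', q) \<in> P"
      using G(2)[OF w(1)] by (auto simp: D_def)
    then have "w' \<in> B" using filter_down[OF G(1)] by (auto simp: B_def)
    then show False using w \<open>w' \<in> W' - S w\<close> by blast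
  qed
  have inc: "\<not> compatible Q (tl w) (tl w')" if w: "w \<in> B" "w' \<in> B" "w \<noteq> w'" for w w'
  proof
    assume "compatible Q (tl w) (tl w')"
    then obtain t where t: "(tl w, t) \<in> Q" "(tl w', t) \<in> Q" by (auto simp: compatible_def)
    obtain s where s: "(hd w, s) \<in> P" "(hd w', s) \<in> P"
      using filter_directed[OF G(1), of "hd w" "hd w'"] w by (auto simp: B_def)
    have "(hd w # tl w, s # t) \<in> ?R" "(hd w' # tl w', s # t) \<in> ?R" using s t by simp_all
    then have "compatible ?R w w'"
      using Cons(3) w unfolding compatible_def B_def by (metis (no_types, lifting) mem_Collect_eq)
    then show False using W W'(1) w unfolding antichain_def B_def by blast
  qed
  have "antichain Q (tl ` B)"
    unfolding antichain_def using inc Cons(2) by (auto simp: B_def)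
  then have "countable (tl ` B)" using Q(2) ccc_countable by blast
  moreover have "inj_on tl B"
  proof (rule inj_onI, rule ccontr)
    fix w w' assume w: "w \<in> B" "w' \<in> B" "tl w = tl w'" "w \<noteq> w'"
    then have "(tl w, tl w) \<in> Q" using Cons(2) forcing_notion_refl[OF Q(1)] by (auto simp: B_def)
    then show False using inc[OF w(1,2,4)] w(3) unfolding compatible_def by auto
  qed
  ultimately show False using unc countable_image_inj_on by blast
qed

text \<open>The first half of a system on the product is evaluated by a filter \<open>G\<close> in
  the ground model. If no condition of the product bounds the system and \<open>G\<close> meets
  enough dense sets, then no condition of \<open>Q\<close> bounds the evaluated system,
  contradicting that \<open>Q\<close> is bounding.\<close>

lemma bounding_cons_rel:
  assumes \<kappa>: "Card_order \<kappa>" "infinite (Field \<kappa>)" and MA: "MA \<kappa> P"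
    and P: "forcing_notion P" "bounding P" and Q: "forcing_notion Q" "bounding Q"
    and card: "|Field Q| \<le>o \<kappa>"
  shows "bounding (cons_rel P Q)"
  unfolding bounding_def bounding_at_def
proof (intro ballI allI impI, rule ccontr)
  let ?R = "cons_rel P Q"
  note reflP = forcing_notion_refl[OF P(1)] and transP = forcing_notion_trans[OF P(1)]
  note reflQ = forcing_notion_refl[OF Q(1)] and transQ = forcing_notion_trans[OF Q(1)]
  have R: "forcing_notion ?R" using forcing_notion_cons_rel P Q by blast
  note inR = Cons_in_Field_cons_rel[OF P(1) Q(1)]
  fix x b assume x: "x \<in> Field ?R" and b: "total_system ?R x b"
    and no: "\<not> (\<exists>q g. (x, q) \<in> ?R \<and> (\<forall>n. dense_above ?R q (\<Union>v\<le>g n. b n v)))"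
  obtain p p' where pp: "x = p # p'" "p \<in> Field P" "p' \<in> Field Q"
    using x by (auto simp: Field_cons_rel[OF P(1) Q(1)])
  \<comment> \<open>The conditions forcing the \<open>k\<close>-th set to have no element
    \<open>\<le> v\<close>.\<close>
  define neg where "neg k v = {w \<in> Field ?R. \<forall>w' u. (w, w') \<in> ?R \<and> u \<le> v \<longrightarrow> w' \<notin> b k u}" for k v
  have neg_open: "w' \<in> neg k u" if "w \<in> neg k v" "(w, w') \<in> ?R" "u \<le> v" for w w' k u v
    using that forcing_notion_trans[OF R that(2)] unfolding neg_def by (auto intro: FieldI2)
  have no': "\<exists>k s s'. (q, s) \<in> P \<and> (q', s') \<in> Q \<and> s # s' \<in> neg k (g k)"
    if q: "(p, q) \<in> P" "(p', q') \<in> Q" for q q' and g :: "nat \<Rightarrow> nat"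
  proof -
    have "(x, q # q') \<in> ?R" using q pp by simp
    then obtain k where "\<not> dense_above ?R (q # q') (\<Union>v\<le>g k. b k v)" using no by blast
    then obtain w where w: "(q # q', w) \<in> ?R" "\<And>u s. u \<le> g k \<Longrightarrow> s \<in> b k u \<Longrightarrow> (w, s) \<notin> ?R"
      by (auto simp: dense_above_def)
    then have "w \<in> neg k (g k)" by (auto simp: neg_def intro: FieldI2)
    then show ?thesis using w(1) by (auto elim!: cons_relE)
  qed
  \<comment> \<open>The first halves over which some extension of \<open>q'\<close> pushes the
    \<open>k\<close>-th set above \<open>v\<close>. These sets are open and shrink as
    \<open>v\<close> grows.\<close>
  define Dn where "Dn q' k v = {s \<in> Field P. \<exists>r. (q', r) \<in> Q \<and> s # r \<in> neg k v}" for q' k v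
  have Dn_open: "t \<in> Dn q' k u" if s: "s \<in> Dn q' k v" and t: "(s, t) \<in> P" and "u \<le> v" for s t q' k u v
  proof -
    obtain r where r: "(q', r) \<in> Q" "s # r \<in> neg k v" using s by (auto simp: Dn_def)
    then have "(s # r, t # r) \<in> ?R" using t reflQ by (auto intro: FieldI2)
    then have "t # r \<in> neg k u" using neg_open r \<open>u \<le> v\<close> by blast
    then show ?thesis using r t by (auto simp: Dn_def intro: FieldI2)
  qed
  \<comment> \<open>The filter has to meet three kinds of sets: \<open>E q'\<close> selects a
    \<open>k\<close> at which every bound can be exceeded by extending \<open>q'\<close>,
    \<open>D q' k v\<close> decides \<open>Dn q' k v\<close>, and \<open>T q' k\<close> keeps the
    evaluated system total.\<close>
  define E where "E q' = {q \<in> Field P. \<exists>k. \<forall>v. dense_above P q (Dn q' k v)}" for q'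
  define D where "D q' k v = {s \<in> Field P. s \<in> Dn q' k v \<or> (\<forall>t. (s, t) \<in> P \<longrightarrow> t \<notin> Dn q' k v)}"
    for q' k v
  define T where "T q' k = {s \<in> Field P. \<exists>v r. (q', r) \<in> Q \<and> s # r \<in> b k v}" for q' k
  have E_dense: "dense_above P p (E q')" if q': "(p', q') \<in> Q" for q'
    unfolding dense_above_def
  proof (intro allI impI, rule ccontr)
    fix q0 assume q0: "(p, q0) \<in> P" and notE: "\<not> (\<exists>s\<in>E q'. (q0, s) \<in> P)"
    \<comment> \<open>Above \<open>q0\<close> nothing lies in \<open>E q'\<close>, so for every
      \<open>k\<close> some value \<open>v\<close> can be fixed that is never exceeded: the system
      \<open>L\<close> is total. Bounding of \<open>P\<close> yields one function \<open>g\<close>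
      limiting all these values at once, against \<open>no'\<close>.\<close>
    define L where "L k v = {s \<in> Field P. \<forall>t. (s, t) \<in> P \<longrightarrow> t \<notin> Dn q' k v}" for k v
    have "total_system P q0 L"
      unfolding total_system_def
    proof (intro conjI allI)
      fix k v show "open_in P (L k v)"
        unfolding open_in_def L_def using transP by (auto intro: FieldI2)
      show "dense_above P q0 (\<Union>v. L k v)"
        unfolding dense_above_def
      proof (intro allI impI)
        fix q assume q: "(q0, q) \<in> P"
        then have "q \<notin> E q'" "q \<in> Field P" using notE by (auto intro: FieldI2)
        then obtain v where "\<not> dense_above P q (Dn q' k v)" by (auto simp: E_def)
        then obtain s where s: "(q, s) \<in> P" "\<forall>t\<in>Dn q' k v. (s, t) \<notin> P"
          by (auto simp: dense_above_def)
        then have "s \<in> L k v" by (auto simp: L_def intro: FieldI2)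
        then show "\<exists>s\<in>\<Union>v. L k v. (q, s) \<in> P" using s by blast
      qed
    qed
    then obtain q1 g where q1: "(q0, q1) \<in> P" and g: "\<And>n. dense_above P q1 (\<Union>v\<le>g n. L n v)"
      by (rule boundingE[OF P(2) FieldI2[OF q0]]) blast
    obtain k s s' where s: "(q1, s) \<in> P" "(q', s') \<in> Q" "s # s' \<in> neg k (g k)"
      using no'[OF transP[OF q0 q1] q', of g] by blast
    then have "s \<in> Dn q' k (g k)" by (auto simp: Dn_def intro: FieldI2)
    moreover obtain v t where t: "v \<le> g k" "t \<in> L k v" "(s, t) \<in> P"
      using dense_aboveD[OF g s(1)] by blast
    ultimately have "t \<in> Dn q' k v" using Dn_open by blast
    moreover have "(t, t) \<in> P" using reflP FieldI2[OF t(3)] by blast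
    ultimately show False using t(2) by (auto simp: L_def)
  qed
  have D_dense: "dense_above P p (D q' k v)" for q' k v
    unfolding dense_above_def
  proof (intro allI impI)
    fix q assume q: "(p, q) \<in> P"
    show "\<exists>s\<in>D q' k v. (q, s) \<in> P"
    proof (cases "\<exists>s\<in>Dn q' k v. (q, s) \<in> P")
      case True
      then show ?thesis by (auto simp: D_def intro: FieldI2)
    next
      case False
      then have "q \<in> D q' k v" using q by (auto simp: D_def intro: FieldI2)
      then show ?thesis using reflP[OF FieldI2[OF q]] by blast
    qed
  qed
  have T_dense: "dense_above P p (T q' k)" if q': "(p', q') \<in> Q" for q' k
    unfolding dense_above_def
  proof (intro allI impI)
    fix q assume "(p, q) \<in> P"
    then have "(x, q # q') \<in> ?R" using q' pp by simp
    then obtain v w where w: "w \<in> b k v" "(q # q', w) \<in> ?R" using total_systemD(2)[OF b] by blast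
    then show "\<exists>s\<in>T q' k. (q, s) \<in> P"
      by (auto simp: T_def elim!: cons_relE intro: FieldI2)
  qed
  define I where "I = {q'. (p', q') \<in> Q} \<times> (UNIV :: (nat \<times> nat \<times> nat) set)"
  define \<D> where "\<D> = (\<lambda>(q', j :: nat, k, v).
    if j = 0 then E q' else if j = 1 then D q' k v else T q' k)"
  have "|I| \<le>o \<kappa>"
  proof -
    have "{q'. (p', q') \<in> Q} \<subseteq> Field Q" by (auto intro: FieldI2)
    then have 1: "|{q'. (p', q') \<in> Q}| \<le>o \<kappa>" using card card_of_mono1 ordLeq_transitive by blast
    have "|UNIV :: (nat \<times> nat \<times> nat) set| \<le>o natLeq"
      by (rule countable_card_le_natLeq[THEN iffD1]) simp
    then have "|UNIV :: (nat \<times> nat \<times> nat) set| \<le>o \<kappa>"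
      using natLeq_ordLeq_cinfinite[of \<kappa>] \<kappa> by (meson cinfinite_def ordLeq_transitive)
    then show ?thesis unfolding I_def using 1 \<kappa> card_of_Times_ordLeq_infinite_Field by blast
  qed
  have sub: "\<D> i \<subseteq> Field P" for i
    by (cases i) (auto simp: \<D>_def E_def D_def T_def)
  obtain G where G: "forcing_filter P G" and meets: "\<And>i. i \<in> I \<Longrightarrow> G \<inter> \<D> i \<noteq> {}"
    by (rule MA_dense[OF MA P(1) \<kappa>(1) \<open>|I| \<le>o \<kappa>\<close> pp(2), of \<D>])
      (use sub E_dense D_dense T_dense in \<open>auto simp: I_def \<D>_def\<close>)
  have GE: "G \<inter> E q' \<noteq> {}" and GD: "G \<inter> D q' k v \<noteq> {}" and GT: "G \<inter> T q' k \<noteq> {}"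
    if "(p', q') \<in> Q" for q' k v
    using that meets[of "(q', 0, k, v)"] meets[of "(q', 1, k, v)"] meets[of "(q', 2, k, v)"]
    by (simp_all add: I_def \<D>_def)
  \<comment> \<open>The system on \<open>Q\<close> that arises when the first half is evaluated by
    \<open>G\<close>.\<close>
  define c where "c k v = {r \<in> Field Q. \<exists>s\<in>G. s # r \<in> b k v}" for k v
  have "total_system Q p' c"
    unfolding total_system_def
  proof (intro conjI allI)
    fix k v show "open_in Q (c k v)"
      unfolding open_in_def
    proof (intro conjI ballI allI impI)
      show "c k v \<subseteq> Field Q" by (auto simp: c_def)
      fix r r' assume r: "r \<in> c k v" "(r, r') \<in> Q"
      then obtain s where s: "s \<in> G" "s # r \<in> b k v" by (auto simp: c_def)
      then have "(s # r, s # r') \<in> ?R" using r reflP filter_Field[OF G] by simp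
      then have "s # r' \<in> b k v" using open_inD[OF total_systemD(1)[OF b] s(2)] by blast
      then show "r' \<in> c k v" using s(1) r(2) by (auto simp: c_def intro: FieldI2)
    qed
    show "dense_above Q p' (\<Union>v. c k v)"
      unfolding dense_above_def
    proof (intro allI impI)
      fix q' assume "(p', q') \<in> Q"
      then obtain s where "s \<in> G" "s \<in> T q' k" using GT by blast
      then show "\<exists>s\<in>\<Union>v. c k v. (q', s) \<in> Q" by (auto simp: T_def c_def intro: FieldI2)
    qed
  qed
  then obtain q' g where q': "(p', q') \<in> Q" and g: "\<And>n. dense_above Q q' (\<Union>v\<le>g n. c n v)"
    by (rule boundingE[OF Q(2) pp(3)]) blast
  \<comment> \<open>Above \<open>q\<close> the set \<open>Dn q' k (g k)\<close> is dense, and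
    \<open>s\<close> decides it; being compatible with \<open>q\<close>, the condition
    \<open>s\<close> belongs to it. So over \<open>s\<close> some extension \<open>r\<close> of
    \<open>q'\<close> pushes the \<open>k\<close>-th set above \<open>g k\<close>, although
    \<open>g\<close> bounds the evaluated system above \<open>q'\<close>.\<close>
  obtain q k where q: "q \<in> G" "\<And>v. dense_above P q (Dn q' k v)"
    using GE[OF q'] by (auto simp: E_def)
  obtain s where s: "s \<in> G" "s \<in> D q' k (g k)" using GD[OF q', of k "g k"] by blast
  obtain t where t: "(q, t) \<in> P" "(s, t) \<in> P" using filter_directed[OF G q(1) s(1)] by blast
  obtain u where u: "u \<in> Dn q' k (g k)" "(t, u) \<in> P" using dense_aboveD[OF q(2) t(1)] by blast
  have "s \<in> Dn q' k (g k)" using s(2) u transP[OF t(2) u(2)] by (auto simp: D_def)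
  then obtain r where r: "(q', r) \<in> Q" "s # r \<in> neg k (g k)" by (auto simp: Dn_def)
  obtain v r' where r': "v \<le> g k" "r' \<in> c k v" "(r, r') \<in> Q" using dense_aboveD[OF g r(1)] by blast
  obtain s1 where s1: "s1 \<in> G" "s1 # r' \<in> b k v" using r'(2) by (auto simp: c_def)
  obtain s2 where s2: "(s, s2) \<in> P" "(s1, s2) \<in> P" using filter_directed[OF G s(1) s1(1)] by blast
  have "(s1 # r', s2 # r') \<in> ?R" using s2 reflQ[OF FieldI2[OF r'(3)]] by simp
  then have "s2 # r' \<in> b k v" using open_inD[OF total_systemD(1)[OF b] s1(2)] by blast
  moreover have "(s # r, s2 # r') \<in> ?R" using s2 r' by simp
  ultimately show False using r(2) r'(1) by (auto simp: neg_def)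
qed

section \<open>Finite powers\<close>

primrec power_rel :: "'p rel \<Rightarrow> nat \<Rightarrow> 'p list rel" where
  "power_rel P 0 = {([], [])}"
| "power_rel P (Suc n) = cons_rel P (power_rel P n)"

lemma power_rel_iff:
  "(xs, ys) \<in> power_rel P n \<longleftrightarrow> length xs = n \<and> length ys = n \<and> (\<forall>i<n. (xs ! i, ys ! i) \<in> P)"
proof (induction n arbitrary: xs ys)
  case (Suc n)
  show ?case
  proof
    assume "(xs, ys) \<in> power_rel P (Suc n)"
    then show "length xs = Suc n \<and> length ys = Suc n \<and> (\<forall>i<Suc n. (xs ! i, ys ! i) \<in> P)"
      using Suc by (auto simp: less_Suc_eq_0_disj elim!: cons_relE)
  next
    assume *: "length xs = Suc n \<and> length ys = Suc n \<and> (\<forall>i<Suc n. (xs ! i, ys ! i) \<in> P)"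
    then obtain x xs' y ys' where "xs = x # xs'" "ys = y # ys'" by (metis length_Suc_conv)
    then show "(xs, ys) \<in> power_rel P (Suc n)" using * Suc by (auto simp: less_Suc_eq_0_disj)
  qed
qed auto

lemma forcing_notion_power_rel: "forcing_notion P \<Longrightarrow> forcing_notion (power_rel P n)"
proof (induction n)
  case 0
  show ?case by (rule forcing_notionI) (auto simp: Field_def)
qed (simp add: forcing_notion_cons_rel)

lemma Field_power_rel:
  assumes P: "forcing_notion P"
  shows "Field (power_rel P n) = {xs. length xs = n \<and> set xs \<subseteq> Field P}"
proof (induction n)
  case 0
  show ?case by (auto simp: Field_def)
next
  case (Suc n)
  show ?case
    by (auto simp: Field_cons_rel[OF P forcing_notion_power_rel[OF P]] Suc length_Suc_conv image_iff)
qed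

text \<open>In each step the new factor \<open>P\<close> in front is the one evaluated by a filter
  in the ground model, so the axiom is invoked for \<open>P\<close> only; of the previous power just
  the chain condition, bounding and the size are used.\<close>

lemma ccc_bounding_power_rel:
  fixes P :: "'p rel"
  assumes \<kappa>: "Card_order \<kappa>" "infinite (Field \<kappa>)" and "MA \<kappa> P" "forcing_notion P" "ccc P" "bounding P"
    and "|Field P| \<le>o \<kappa>"
  shows "|Field (power_rel P n)| \<le>o \<kappa> \<and> ccc (power_rel P n) \<and> bounding (power_rel P n)"
proof (induction n)
  case 0
  have F: "Field (power_rel P 0) = {[]}" by (auto simp: Field_def)
  have "|{[] :: 'p list}| \<le>o \<kappa>"
    by (rule ordLeq_transitive[OF _ natLeq_ordLeq_cinfinite])
      (use \<kappa> in \<open>simp_all add: cinfinite_def flip: countable_card_le_natLeq\<close>)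
  moreover have "ccc (power_rel P 0)"
    unfolding ccc_def antichain_def F by (meson countable_finite finite.simps finite_subset)
  moreover have "bounding (power_rel P 0)"
    unfolding bounding_def bounding_at_def F
  proof (intro ballI allI impI)
    fix p :: "'p list" and b assume p: "p \<in> {[]}" and b: "total_system (power_rel P 0) p b"
    then have "\<exists>v. [] \<in> b n v" for n using total_systemD(2)[OF b, of "[]" n] by auto
    then obtain g where "\<And>n. [] \<in> b n (g n)" by metis
    then show "\<exists>q g. (p, q) \<in> power_rel P 0 \<and>
        (\<forall>n. dense_above (power_rel P 0) q (\<Union>v\<le>g n. b n v))"
      using p by (intro exI[of _ "[]"] exI[of _ g]) (auto simp: dense_above_def)
  qed
  ultimately show ?case by (simp add: F del: power_rel.simps)
next
  case (Suc n)
  note R = forcing_notion_power_rel[OF assms(4)]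
  have "|Field (cons_rel P (power_rel P n))| \<le>o \<kappa>"
    using card_Field_cons_rel[OF assms(4) R \<kappa> assms(7)] Suc by blast
  moreover from this have "ccc (cons_rel P (power_rel P n))"
    using ccc_cons_rel[OF \<kappa>(1) assms(3,4,5) R] Suc by blast
  moreover have "bounding (cons_rel P (power_rel P n))"
    using bounding_cons_rel[OF \<kappa> assms(3,4,6) R] Suc by blast
  ultimately show ?case by simp
qed

text \<open>The chain condition makes one function serve all of \<open>D\<close>: an antichain
  maximal among the conditions that bound \<open>b\<close> is countable, and one function eventually
  dominates its bounds. The starting point \<open>k0\<close> depends on the element of the antichain
  met above \<open>q\<close>.\<close>

lemma ccc_bounding_uniform:
  assumes r: "forcing_notion r" "ccc r" "bounding r"
    and D: "D \<subseteq> Field r" "\<And>q. q \<in> D \<Longrightarrow> total_system r q b"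
  obtains g where "\<And>q. q \<in> D \<Longrightarrow>
    \<exists>q' k0. (q, q') \<in> r \<and> (\<forall>k\<ge>k0. dense_above r q' (\<Union>v\<le>g k. b k v))"
proof -
  define good where "good = {a \<in> Field r. \<exists>g. \<forall>n. dense_above r a (\<Union>v\<le>g n. b n v)}"
  obtain A where A: "A \<subseteq> good" "antichain r A" "\<And>d. d \<in> good \<Longrightarrow> \<exists>a\<in>A. compatible r a d"
    by (rule antichain_in_set[OF r(1), of good]) (auto simp: good_def)
  have cA: "countable A" using ccc_countable[OF r(2) A(2)] .
  have "\<forall>a\<in>A. \<exists>g. \<forall>n. dense_above r a (\<Union>v\<le>g n. b n v)" using A(1) by (auto simp: good_def)
  then obtain g where g: "\<forall>a\<in>A. \<forall>n. dense_above r a (\<Union>v\<le>g a n. b n v)"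
    by (rule bchoice[THEN exE])
  obtain h where h: "\<And>m k. m \<le> k \<Longrightarrow> g (from_nat_into A m) k < h k"
    by (rule dominate_countable[of "\<lambda>m. g (from_nat_into A m)"]) blast
  show ?thesis
  proof (rule that)
    fix q assume q: "q \<in> D"
    then obtain d g' where d: "(q, d) \<in> r" "\<And>n. dense_above r d (\<Union>v\<le>g' n. b n v)"
      by (rule boundingE[OF r(3) subsetD[OF D(1)] D(2)]) (use q in blast)+
    then have "d \<in> good" unfolding good_def by (blast intro: FieldI2)
    then obtain a where a: "a \<in> A" "compatible r a d" using A(3) by blast
    then obtain t where t: "(a, t) \<in> r" "(d, t) \<in> r" by (auto simp: compatible_def)
    obtain m where m: "from_nat_into A m = a" using from_nat_into_surj[OF cA a(1)] by blast
    have "dense_above r t (\<Union>v\<le>h k. b k v)" if "m \<le> k" for k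
    proof (rule dense_above_mono)
      show "dense_above r t (\<Union>v\<le>g a k. b k v)" using dense_above_trans[OF r(1) _ t(1)] g a(1) by blast
      show "(\<Union>v\<le>g a k. b k v) \<subseteq> (\<Union>v\<le>h k. b k v)" using h[OF that] m by force
    qed
    then show "\<exists>q' k0. (q, q') \<in> r \<and> (\<forall>k\<ge>k0. dense_above r q' (\<Union>v\<le>h k. b k v))"
      using forcing_notion_trans[OF r(1) d(1) t(2)] by blast
  qed
qed

section \<open>Finite support powers\<close>

text \<open>Finite supports are encoded by lists of varying length. A missing coordinate carries no
  information, so \<open>[]\<close> is a weakest condition even when \<open>P\<close> has
  none.\<close>

definition fs_power :: "'p rel \<Rightarrow> 'p list rel" where
  "fs_power P = {(xs, ys). length xs \<le> length ys \<and> set ys \<subseteq> Field P \<and>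
     (\<forall>i<length xs. (xs ! i, ys ! i) \<in> P)}"

lemma fs_powerI:
  "length xs \<le> length ys \<Longrightarrow> set ys \<subseteq> Field P \<Longrightarrow> (\<And>i. i < length xs \<Longrightarrow> (xs ! i, ys ! i) \<in> P) \<Longrightarrow>
    (xs, ys) \<in> fs_power P"
  by (simp add: fs_power_def)

lemma fs_power_refl: "forcing_notion P \<Longrightarrow> set xs \<subseteq> Field P \<Longrightarrow> (xs, xs) \<in> fs_power P"
  by (rule fs_powerI) (auto intro!: forcing_notion_refl)

lemma Field_fs_power:
  assumes P: "forcing_notion P"
  shows "Field (fs_power P) = {xs. set xs \<subseteq> Field P}"
proof
  show "Field (fs_power P) \<subseteq> {xs. set xs \<subseteq> Field P}"
    by (auto simp: Field_def Domain_iff Range_iff fs_power_def in_set_conv_nth)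
      (blast intro: FieldI1)
  show "{xs. set xs \<subseteq> Field P} \<subseteq> Field (fs_power P)"
    using fs_power_refl[OF P] by (auto intro: FieldI1)
qed

lemma forcing_notion_fs_power:
  assumes P: "forcing_notion P"
  shows "forcing_notion (fs_power P)"
proof (rule forcing_notionI)
  fix xs ys zs assume *: "(xs, ys) \<in> fs_power P" "(ys, zs) \<in> fs_power P"
  show "(xs, zs) \<in> fs_power P"
  proof (rule fs_powerI)
    fix i assume "i < length xs"
    then have "(xs ! i, ys ! i) \<in> P" "(ys ! i, zs ! i) \<in> P" using * by (auto simp: fs_power_def)
    then show "(xs ! i, zs ! i) \<in> P" by (rule forcing_notion_trans[OF P])
  qed (use * in \<open>auto simp: fs_power_def\<close>)
next
  have "[] \<in> Field (fs_power P)" by (simp add: Field_fs_power[OF P])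
  then show "Field (fs_power P) \<noteq> {}" by blast
qed (simp add: Field_fs_power[OF P] fs_power_refl[OF P])

lemma power_rel_subset_fs_power:
  assumes "(xs, ys) \<in> power_rel P n"
  shows "(xs, ys) \<in> fs_power P"
  using assms by (auto simp: power_rel_iff fs_power_def in_set_conv_nth) (metis FieldI2)

lemma fs_power_nth: "(xs, ys) \<in> fs_power P \<Longrightarrow> i < length xs \<Longrightarrow> i < length ys \<and> (xs ! i, ys ! i) \<in> P"
  by (auto simp: fs_power_def)

lemma card_Field_fs_power:
  assumes \<kappa>: "Card_order \<kappa>" "infinite (Field \<kappa>)" and P: "forcing_notion P"
    and card: "\<And>n. |Field (power_rel P n)| \<le>o \<kappa>"
  shows "|Field (fs_power P)| \<le>o \<kappa>"
proof -
  have "Field (fs_power P) = (\<Union>n. Field (power_rel P n))"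
    by (auto simp: Field_fs_power[OF P] Field_power_rel[OF P])
  moreover have "|UNIV :: nat set| \<le>o \<kappa>"
    by (rule ordLeq_transitive[OF _ natLeq_ordLeq_cinfinite])
      (use \<kappa> in \<open>simp_all add: cinfinite_def flip: countable_card_le_natLeq\<close>)
  ultimately show ?thesis
    using card_of_UNION_ordLeq_infinite_Field[OF \<kappa>(2,1), of UNIV "\<lambda>n. Field (power_rel P n)"] card
    by simp
qed

text \<open>Lists of equal length that are incompatible here are already incompatible in the finite
  power of that length, and there are only countably many lengths.\<close>

lemma ccc_fs_power:
  assumes P: "forcing_notion P" and ccc: "\<And>n. ccc (power_rel P n)"
  shows "ccc (fs_power P)"
  unfolding ccc_def
proof (intro allI impI)
  fix W assume W: "antichain (fs_power P) W"
  have "antichain (power_rel P n) {w \<in> W. length w = n}" for n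
    using W power_rel_subset_fs_power[of _ _ P n]
    unfolding antichain_def compatible_def Field_fs_power[OF P] Field_power_rel[OF P] by blast
  then have "countable {w \<in> W. length w = n}" for n using ccc_countable[OF ccc] by blast
  then have "countable (\<Union>n. {w \<in> W. length w = n})" by blast
  moreover have "W = (\<Union>n. {w \<in> W. length w = n})" by blast
  ultimately show "countable W" by simp
qed

text \<open>
  For a name of a function on the power and \<open>m < \<omega>\<close>, the least possible values over the generic
  of the \<open>m\<close>-th power form a function named in that power, and each condition of the finite
  support power lies in one of the finite powers.
\<close>

lemma strongly_almost_bounding_fs_power:
  assumes P: "forcing_notion P" and ccc: "\<And>n. ccc (power_rel P n)" and bd: "\<And>n. bounding (power_rel P n)"
  shows "strongly_almost_bounding (fs_power P)"
proof (rule strongly_almost_boundingI[OF forcing_notion_fs_power[OF P]])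
  let ?F = "fs_power P"
  note trans = forcing_notion_trans[OF forcing_notion_fs_power[OF P]]
  note ptrans = forcing_notion_trans[OF forcing_notion_power_rel[OF P]]
  fix p b assume p: "p \<in> Field ?F" and b: "total_system ?F p b"
  \<comment> \<open>Over a condition \<open>a\<close> in \<open>L m k v\<close> the coordinates from
    \<open>m\<close> on can still be chosen so that some value \<open>\<le> v\<close> enters the
    \<open>k\<close>-th set.\<close>
  define L where "L m k v = {a. \<exists>c u. u \<le> v \<and> c \<in> b k u \<and> m \<le> length c \<and> (take m c, a) \<in> power_rel P m}"
    for m k v
  have "total_system (power_rel P m) q (L m)" if q: "(p, q) \<in> ?F" "length q = m" for q m
    unfolding total_system_def
  proof (intro conjI allI)
    fix k v
    show "open_in (power_rel P m) (L m k v)"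
      unfolding open_in_def L_def using ptrans[of _ _ m] by (blast intro: FieldI2)
    show "dense_above (power_rel P m) q (\<Union>v. L m k v)"
      unfolding dense_above_def
    proof (intro allI impI)
      fix a assume a: "(q, a) \<in> power_rel P m"
      then have "(p, a) \<in> ?F" using trans[OF q(1) power_rel_subset_fs_power] by blast
      then obtain v c where c: "c \<in> b k v" "(a, c) \<in> ?F" using total_systemD(2)[OF b] by blast
      have la: "length a = m" using a by (simp add: power_rel_iff)
      have lc: "m \<le> length c" "set c \<subseteq> Field P" using c(2) la by (auto simp: fs_power_def)
      have "(a, take m c) \<in> power_rel P m"
        using c(2) la lc by (auto simp: power_rel_iff fs_power_def)
      moreover have "(take m c, take m c) \<in> power_rel P m"
        using lc by (auto simp: power_rel_iff intro!: forcing_notion_refl[OF P])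
      ultimately show "\<exists>s\<in>\<Union>v. L m k v. (a, s) \<in> power_rel P m"
        using c(1) lc(1) unfolding L_def by blast
    qed
  qed
  \<comment> \<open>For each length \<open>m\<close> one function takes care of all conditions of
    that length, up to an extension and a finite initial part; over all \<open>m\<close> this gives
    the countable family of bounds.\<close>
  then have "\<exists>g. \<forall>q. (p, q) \<in> ?F \<and> length q = m \<longrightarrow>
      (\<exists>q' k0. (q, q') \<in> power_rel P m \<and> (\<forall>k\<ge>k0. dense_above (power_rel P m) q' (\<Union>v\<le>g k. L m k v)))" for m
    by (rule_tac ccc_bounding_uniform[OF forcing_notion_power_rel[OF P] ccc bd,
          of "{q. (p, q) \<in> ?F \<and> length q = m}" m "L m"])
      (auto simp: Field_power_rel[OF P] fs_power_def)
  then have "\<forall>m. \<exists>g. \<forall>q. (p, q) \<in> ?F \<and> length q = m \<longrightarrow>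
      (\<exists>q' k0. (q, q') \<in> power_rel P m \<and> (\<forall>k\<ge>k0. dense_above (power_rel P m) q' (\<Union>v\<le>g k. L m k v)))"
    by (rule allI)
  then obtain g :: "nat \<Rightarrow> nat \<Rightarrow> nat" where g: "\<forall>m. \<forall>q. (p, q) \<in> ?F \<and> length q = m \<longrightarrow>
      (\<exists>q' k0. (q, q') \<in> power_rel P m \<and> (\<forall>k\<ge>k0. dense_above (power_rel P m) q' (\<Union>v\<le>g m k. L m k v)))"
    by (rule choice[THEN exE])
  show "\<exists>g :: nat \<Rightarrow> nat \<Rightarrow> nat. \<forall>s. (p, s) \<in> ?F \<longrightarrow>
        (\<exists>m k0. \<forall>k\<ge>k0. \<exists>v\<le>g m k. \<exists>t\<in>b k v. (s, t) \<in> ?F)"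
  proof (intro exI[of _ g] allI impI)
    fix s assume s: "(p, s) \<in> ?F"
    define m where "m = length s"
    obtain q' k0 where q': "(s, q') \<in> power_rel P m"
      and dn: "\<forall>k\<ge>k0. dense_above (power_rel P m) q' (\<Union>v\<le>g m k. L m k v)"
      using g[rule_format, of s m] s by (auto simp: m_def)
    have rf: "(q', q') \<in> power_rel P m"
      by (rule forcing_notion_refl[OF forcing_notion_power_rel[OF P] FieldI2[OF q']])
    have "\<exists>v\<le>g m k. \<exists>t\<in>b k v. (s, t) \<in> ?F" if k: "k0 \<le> k" for k
    proof -
      have "\<exists>a\<in>(\<Union>v\<le>g m k. L m k v). (q', a) \<in> power_rel P m"
        by (rule dense_aboveD[OF dn[rule_format, OF k] rf])
      then obtain a c u where a: "(q', a) \<in> power_rel P m" and c: "u \<le> g m k" "c \<in> b k u"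
        "m \<le> length c" "(take m c, a) \<in> power_rel P m" unfolding L_def by (blast intro: le_trans)
      have "c \<in> Field ?F" using c(2) total_systemD(1)[OF b] by (auto simp: open_in_def)
      then have sc: "set c \<subseteq> Field P" by (simp add: Field_fs_power[OF P])
      have "a \<in> Field (power_rel P m)" using a by (rule FieldI2)
      then have la: "length a = m" "set a \<subseteq> Field P" by (simp_all add: Field_power_rel[OF P])
      \<comment> \<open>\<open>a\<close> restricts only the first \<open>m\<close> coordinates, so
        the rest of \<open>c\<close> can be appended to it; the result extends both \<open>c\<close>
        and \<open>s\<close>.\<close>
      have st: "set (a @ drop m c) \<subseteq> Field P" using la sc by (auto dest: in_set_dropD)
      have "(c, a @ drop m c) \<in> ?F"
      proof (rule fs_powerI[OF _ st])
        fix i assume "i < length c"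
        then show "(c ! i, (a @ drop m c) ! i) \<in> P"
          using c(3,4) la(1) sc
          by (auto simp: nth_append power_rel_iff intro!: forcing_notion_refl[OF P])
      qed (use la c(3) in simp)
      then have "a @ drop m c \<in> b k u" using open_inD[OF total_systemD(1)[OF b] c(2)] by blast
      moreover have "(s, a @ drop m c) \<in> ?F"
      proof (rule fs_powerI[OF _ st])
        fix i assume "i < length s"
        then show "(s ! i, (a @ drop m c) ! i) \<in> P"
          using ptrans[OF q' a] by (simp add: nth_append power_rel_iff m_def)
      qed (use la in \<open>simp add: m_def\<close>)
      ultimately show ?thesis using c(1) by blast
    qed
    then show "\<exists>m k0. \<forall>k\<ge>k0. \<exists>v\<le>g m k. \<exists>t\<in>b k v. (s, t) \<in> ?F" by blast
  qed
qed

section \<open>Under Martin's axiom small atomless forcing notions are not bounding\<close>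

text \<open>In a finite order, a condition with the fewest extensions has the same extensions as
  each of its extensions, so no two of them are incompatible.\<close>

lemma infinite_Field_atomless:
  assumes r: "forcing_notion r" "atomless r"
  shows "infinite (Field r)"
proof
  assume fin: "finite (Field r)"
  let ?up = "\<lambda>p. {q. (p, q) \<in> r}"
  have fin_up: "finite (?up p)" for p by (rule finite_subset[OF _ fin]) (auto intro: FieldI2)
  obtain p0 where "p0 \<in> Field r" using r(1) by (auto simp: forcing_notion_def)
  then obtain p where p: "p \<in> Field r" "\<And>q. q \<in> Field r \<Longrightarrow> card (?up p) \<le> card (?up q)"
    using ex_has_least_nat[of "\<lambda>p. p \<in> Field r" p0 "\<lambda>p. card (?up p)"] by blast
  then obtain q s where qs: "(p, q) \<in> r" "(p, s) \<in> r" "\<not> compatible r q s"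
    using r(2) by (auto simp: atomless_def)
  have "?up q \<subseteq> ?up p" using forcing_notion_trans[OF r(1) qs(1)] by blast
  moreover have "card (?up p) \<le> card (?up q)" using p(2) qs(1) by (blast intro: FieldI2)
  ultimately have "?up q = ?up p" using card_seteq[OF fin_up] by blast
  then have "(q, s) \<in> r" using qs(2) by blast
  moreover have "(s, s) \<in> r" by (rule forcing_notion_refl[OF r(1) FieldI2[OF qs(2)]])
  ultimately show False using qs(3) by (auto simp: compatible_def)
qed

text \<open>
  The name of the function sending \<open>n\<close> to the index of a condition outside \<open>G n\<close> in the generic
  filter cannot be bounded by a condition of \<open>G n\<close> for any \<open>n\<close>.
\<close>

lemma not_bounding:
  fixes P :: "'p rel" and G :: "nat \<Rightarrow> 'p set"
  assumes P: "forcing_notion P" "atomless P" "ccc P"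
    and filters: "\<And>n. forcing_filter P (G n)" "\<And>p. p \<in> Field P \<Longrightarrow> \<exists>n. p \<in> G n"
    and decide: "\<And>n p. p \<in> Field P \<Longrightarrow> p \<in> G n \<or> (\<exists>b\<in>G n. \<not> compatible P p b)"
  shows "\<not> bounding P"
proof
  assume bd: "bounding P"
  \<comment> \<open>The conditions forcing some element of \<open>G n\<close> out of the generic
    filter. They are dense: of two incompatible conditions one is outside \<open>G n\<close>, and
    \<open>decide\<close> applies to it.\<close>
  define D where "D n = {a \<in> Field P. \<exists>b\<in>G n. \<not> compatible P a b}" for n
  have D_dense: "\<exists>s\<in>D n. (p, s) \<in> P" if p: "p \<in> Field P" for n p
  proof -
    obtain q s where qs: "(p, q) \<in> P" "(p, s) \<in> P" "\<not> compatible P q s"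
      using P(2) p by (auto simp: atomless_def)
    have "q \<notin> G n \<or> s \<notin> G n"
      using filter_directed[OF filters(1)] qs(3) by (auto simp: compatible_def)
    then show ?thesis using decide[OF FieldI2[OF qs(1)]] decide[OF FieldI2[OF qs(2)]] qs(1,2)
      unfolding D_def by (blast intro: FieldI2)
  qed
  have "\<exists>A. A \<subseteq> D n \<and> maximal_antichain P A \<and> (\<forall>p\<in>Field P. \<exists>a\<in>A. compatible P a p)" for n
    by (rule dense_contains_maximal_antichain[OF P(1), of "D n"]) (use D_dense in \<open>auto simp: D_def\<close>)
  then obtain A where A: "\<And>n. A n \<subseteq> D n" "\<And>n. maximal_antichain P (A n)"
    "\<And>n p. p \<in> Field P \<Longrightarrow> \<exists>a\<in>A n. compatible P a p" by metis
  obtain p0 where p0: "p0 \<in> Field P" using P(1) by (auto simp: forcing_notion_def)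
  have cA: "countable (A n)" "A n \<noteq> {}" for n
    using A(2)[of n] A(3)[OF p0, of n] ccc_countable[OF P(3)] by (auto simp: maximal_antichain_def)
  \<comment> \<open>Enumerating the antichain turns its generic element into a number;
    \<open>b\<close> is the system for this number.\<close>
  define e where "e n = from_nat_into (A n)" for n
  have e: "e n k \<in> D n" for n k using A(1) from_nat_into[OF cA(2)] by (auto simp: e_def)
  define b where "b n v = {x. (e n v, x) \<in> P}" for n v
  have "total_system P p0 b"
    unfolding total_system_def
  proof (intro conjI allI)
    fix n v
    show "open_in P (b n v)"
      unfolding open_in_def b_def using forcing_notion_trans[OF P(1)] by (auto intro: FieldI2)
    show "dense_above P p0 (\<Union>v. b n v)"
      unfolding dense_above_def
    proof (intro allI impI)
      fix q assume "(p0, q) \<in> P"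
      then obtain a where a: "a \<in> A n" "compatible P a q" using A(3)[OF FieldI2] by blast
      then obtain k where "e n k = a" using from_nat_into_surj[OF cA(1)] by (auto simp: e_def)
      then show "\<exists>s\<in>\<Union>v. b n v. (q, s) \<in> P" using a(2) by (auto simp: compatible_def b_def)
    qed
  qed
  then obtain q g where q: "(p0, q) \<in> P" and g: "\<And>n. dense_above P q (\<Union>v\<le>g n. b n v)"
    by (rule boundingE[OF bd p0]) blast
  obtain n where n: "q \<in> G n" using filters(2)[OF FieldI2[OF q]] by blast
  \<comment> \<open>\<open>c k\<close> excludes \<open>e n k\<close>. The filter \<open>G n\<close>
    contains a common extension of \<open>q\<close> and the finitely many \<open>c k\<close> with
    \<open>k \<le> g n\<close>, and this extension is incompatible with every value allowed by
    \<open>g\<close>.\<close>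
  have "\<forall>k. \<exists>c. c \<in> G n \<and> \<not> compatible P (e n k) c" using e[of n] by (auto simp: D_def)
  then obtain c where c: "\<And>k. c k \<in> G n" "\<And>k. \<not> compatible P (e n k) (c k)" by metis
  have "\<exists>s\<in>G n. (q, s) \<in> P \<and> (\<forall>k\<in>K. (c k, s) \<in> P)" if "finite K" for K
    using that
  proof induction
    case empty
    then show ?case using n forcing_notion_refl[OF P(1) FieldI2[OF q]] by blast
  next
    case (insert k K)
    then obtain s where s: "s \<in> G n" "(q, s) \<in> P" "\<forall>k\<in>K. (c k, s) \<in> P" by blast
    obtain t where "t \<in> G n" "(s, t) \<in> P" "(c k, t) \<in> P"
      using filter_directed[OF filters(1) s(1) c(1)] by blast
    then show ?case using s forcing_notion_trans[OF P(1) _ \<open>(s, t) \<in> P\<close>] by blast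
  qed
  then obtain s where s: "(q, s) \<in> P" "\<forall>k\<in>{..g n}. (c k, s) \<in> P" by blast
  obtain v t where "v \<le> g n" "t \<in> b n v" "(s, t) \<in> P" using dense_aboveD[OF g s(1)] by blast
  then have "compatible P (e n v) (c v)"
    using s(2) forcing_notion_trans[OF P(1)] unfolding compatible_def b_def by blast
  then show False using c(2) by blast
qed

text \<open>The filters are the coordinates of a sufficiently generic filter \<open>H\<close> for
  the finite support power. Meeting \<open>A p\<close> puts \<open>p\<close> into one of them;
  meeting \<open>B n p\<close> makes the \<open>n\<close>-th one contain \<open>p\<close> or a
  condition incompatible with it.\<close>

lemma MA_fs_power_filters:
  assumes \<kappa>: "Card_order \<kappa>" "infinite (Field \<kappa>)" and P: "forcing_notion P" "|Field P| \<le>o \<kappa>"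
    and MA: "MA \<kappa> (fs_power P)"
  obtains G where "\<And>n. forcing_filter P (G n)" "\<And>p. p \<in> Field P \<Longrightarrow> \<exists>n :: nat. p \<in> G n"
    "\<And>n p. p \<in> Field P \<Longrightarrow> p \<in> G n \<or> (\<exists>b\<in>G n. \<not> compatible P p b)"
proof -
  let ?F = "fs_power P"
  obtain p0 where p0: "p0 \<in> Field P" using P(1) by (auto simp: forcing_notion_def)
  define A where "A p = {c. set c \<subseteq> Field P \<and> (\<exists>n<length c. (p, c ! n) \<in> P)}" for p
  define B where "B n p = {c. set c \<subseteq> Field P \<and> n < length c \<and> ((p, c ! n) \<in> P \<or> \<not> compatible P p (c ! n))}"
    for n p
  define D where "D = (\<lambda>(p, n, j). if j then A p else B n p)"
  define I where "I = Field P \<times> (UNIV :: (nat \<times> bool) set)"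
  have sub: "D i \<subseteq> Field ?F" for i
    by (cases i) (auto simp: D_def A_def B_def Field_fs_power[OF P(1)])
  have A_dense: "dense_above ?F [] (A p)" if p: "p \<in> Field P" for p
    unfolding dense_above_def
  proof (intro allI impI)
    fix c assume "([], c) \<in> ?F"
    then have c: "set c \<subseteq> Field P" by (simp add: fs_power_def)
    have "(c, c @ [p]) \<in> ?F"
      by (rule fs_powerI) (use c p in \<open>auto simp: nth_append intro!: forcing_notion_refl[OF P(1)]\<close>)
    moreover have "c @ [p] \<in> A p"
      using c p forcing_notion_refl[OF P(1) p] by (auto simp: A_def intro!: exI[of _ "length c"])
    ultimately show "\<exists>s\<in>A p. (c, s) \<in> ?F" by blast
  qed
  have B_dense: "dense_above ?F [] (B n p)" if p: "p \<in> Field P" for n p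
    unfolding dense_above_def
  proof (intro allI impI)
    fix c assume "([], c) \<in> ?F"
    then have c: "set c \<subseteq> Field P" by (simp add: fs_power_def)
    \<comment> \<open>Padding with the arbitrary condition \<open>p0\<close> makes coordinate
      \<open>n\<close> available.\<close>
    define d where "d = c @ replicate (Suc n) p0"
    have d: "set d \<subseteq> Field P" "n < length d" "length c \<le> length d" "\<And>i. i < length c \<Longrightarrow> d ! i = c ! i"
      using c p0 by (auto simp: d_def nth_append)
    show "\<exists>s\<in>B n p. (c, s) \<in> ?F"
    proof (cases "compatible P p (d ! n)")
      case True
      then obtain t where t: "(p, t) \<in> P" "(d ! n, t) \<in> P" by (auto simp: compatible_def)
      have st: "set (d[n := t]) \<subseteq> Field P"
        using set_update_subset_insert[of d n t] d(1) FieldI2[OF t(1)] by blast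
      have "(c, d[n := t]) \<in> ?F"
      proof (rule fs_powerI[OF _ st])
        fix i assume i: "i < length c"
        then have "(c ! i, c ! i) \<in> P" using c by (auto intro!: forcing_notion_refl[OF P(1)])
        then show "(c ! i, d[n := t] ! i) \<in> P" using d i t by (cases "i = n") auto
      qed (use d in simp)
      moreover have "d[n := t] \<in> B n p" using st d t by (simp add: B_def)
      ultimately show ?thesis by blast
    next
      case False
      have "(c, d) \<in> ?F"
        by (rule fs_powerI) (use c d in \<open>auto intro!: forcing_notion_refl[OF P(1)]\<close>)
      then show ?thesis using False d by (auto simp: B_def)
    qed
  qed
  have "|I| \<le>o \<kappa>"
  proof -
    have "|UNIV :: (nat \<times> bool) set| \<le>o natLeq"
      by (rule countable_card_le_natLeq[THEN iffD1]) simp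
    then have "|UNIV :: (nat \<times> bool) set| \<le>o \<kappa>"
      using natLeq_ordLeq_cinfinite[of \<kappa>] \<kappa> by (meson cinfinite_def ordLeq_transitive)
    then show ?thesis unfolding I_def using P(2) \<kappa> card_of_Times_ordLeq_infinite_Field by blast
  qed
  have nil: "[] \<in> Field ?F" by (simp add: Field_fs_power[OF P(1)])
  obtain H where H: "forcing_filter ?F H" and meets: "\<And>i. i \<in> I \<Longrightarrow> H \<inter> D i \<noteq> {}"
    by (rule MA_dense[OF MA forcing_notion_fs_power[OF P(1)] \<kappa>(1) \<open>|I| \<le>o \<kappa>\<close> nil, of D])
      (use sub A_dense B_dense in \<open>auto simp: I_def D_def\<close>)
  have HA: "\<exists>c\<in>H. c \<in> A p" and HB: "\<exists>c\<in>H. c \<in> B n p" if "p \<in> Field P" for n p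
    using that meets[of "(p, n, True)"] meets[of "(p, n, False)"] by (auto simp: I_def D_def)
  define G where "G n = {p. \<exists>c\<in>H. n < length c \<and> (p, c ! n) \<in> P}" for n
  have nth_G: "c ! n \<in> G n" if c: "c \<in> H" "n < length c" for c n
  proof -
    have "set c \<subseteq> Field P" using filter_Field[OF H c(1)] by (simp add: Field_fs_power[OF P(1)])
    then have "(c ! n, c ! n) \<in> P" using c(2) by (auto intro!: forcing_notion_refl[OF P(1)])
    then show ?thesis using c by (auto simp: G_def)
  qed
  show ?thesis
  proof (rule that)
    fix n
    show "forcing_filter P (G n)"
      unfolding forcing_filter_def
    proof (intro conjI allI ballI impI)
      show "G n \<subseteq> Field P" by (auto simp: G_def intro: FieldI1)
      show "G n \<noteq> {}" using HB[OF p0, of n] nth_G by (auto simp: B_def)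
    next
      fix p q assume "(p, q) \<in> P \<and> q \<in> G n"
      then show "p \<in> G n" using forcing_notion_trans[OF P(1)] by (auto simp: G_def)
    next
      fix p q assume "p \<in> G n" "q \<in> G n"
      then obtain c d where c: "c \<in> H" "n < length c" "(p, c ! n) \<in> P"
        and d: "d \<in> H" "n < length d" "(q, d ! n) \<in> P" by (auto simp: G_def)
      obtain s where s: "s \<in> H" "(c, s) \<in> ?F" "(d, s) \<in> ?F" using filter_directed[OF H c(1) d(1)] by blast
      have "(p, s ! n) \<in> P" "(q, s ! n) \<in> P" "n < length s"
        using forcing_notion_trans[OF P(1)] fs_power_nth[OF s(2) c(2)] fs_power_nth[OF s(3) d(2)] c d
        by blast+
      then show "\<exists>s\<in>G n. (p, s) \<in> P \<and> (q, s) \<in> P" using nth_G[OF s(1)] by blast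
    qed
  next
    fix p assume "p \<in> Field P"
    then show "\<exists>n. p \<in> G n" using HA unfolding A_def G_def by blast
  next
    fix n p assume "p \<in> Field P"
    then obtain c where c: "c \<in> H" "c \<in> B n p" using HB by blast
    then have "n < length c" "(p, c ! n) \<in> P \<or> \<not> compatible P p (c ! n)" by (auto simp: B_def)
    moreover from this have "p \<in> G n" if "(p, c ! n) \<in> P" using that c(1) by (auto simp: G_def)
    ultimately show "p \<in> G n \<or> (\<exists>b\<in>G n. \<not> compatible P p b)" using nth_G[OF c(1)] by blast
  qed
qed

lemma infinite_Field_cardinal:
  assumes "Card_order \<kappa>" "forcing_notion P" "atomless P" "|Field P| \<le>o \<kappa>"
  shows "infinite (Field \<kappa>)"
proof
  assume "finite (Field \<kappa>)"
  moreover have "|Field P| \<le>o |Field \<kappa>|"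
    by (rule ordLeq_ordIso_trans[OF assms(4) ordIso_symmetric[OF card_of_Field_ordIso[OF assms(1)]]])
  ultimately show False using card_of_ordLeq_finite infinite_Field_atomless[OF assms(2,3)] by blast
qed

text \<open>If \<open>P\<close> were bounding, the axiom would hold for \<open>P\<close>, so the
  finite powers would be ccc and bounding and the axiom would also hold for the finite support
  power. The countably many filters it yields contradict bounding by
  \<open>not_bounding\<close>.\<close>

lemma MA_not_bounding:
  fixes \<kappa> :: "'k rel" and P :: "'p rel"
  assumes \<kappa>: "Card_order \<kappa>" "\<kappa> \<le>o |UNIV :: 'u set|"
    and MA: "MA_ccc_almost_bounding TYPE('u) \<kappa>"
    and P: "forcing_notion P" "atomless P" "ccc P" "|Field P| \<le>o \<kappa>"
  shows "\<not> bounding P"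
proof
  assume bd: "bounding P"
  have inf: "infinite (Field \<kappa>)" by (rule infinite_Field_cardinal[OF \<kappa>(1) P(1,2,4)])
  have "MA \<kappa> P"
    by (rule MA_transfer[OF MA ordLeq_transitive[OF P(4) \<kappa>(2)] P(1,3)
          bounding_imp_strongly_almost_bounding[OF P(1) bd]])
  note * = ccc_bounding_power_rel[OF \<kappa>(1) inf this P(1,3) bd P(4)]
  have card: "|Field (fs_power P)| \<le>o \<kappa>"
    by (rule card_Field_fs_power[OF \<kappa>(1) inf P(1)]) (use * in blast)
  have "MA \<kappa> (fs_power P)"
    by (rule MA_transfer[OF MA ordLeq_transitive[OF card \<kappa>(2)] forcing_notion_fs_power[OF P(1)]
          ccc_fs_power[OF P(1)] strongly_almost_bounding_fs_power[OF P(1)]]) (use * in blast)+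
  then obtain G where "\<And>n. forcing_filter P (G n)" "\<And>p. p \<in> Field P \<Longrightarrow> \<exists>n :: nat. p \<in> G n"
    "\<And>n p. p \<in> Field P \<Longrightarrow> p \<in> G n \<or> (\<exists>b\<in>G n. \<not> compatible P p b)"
    by (rule MA_fs_power_filters[OF \<kappa>(1) inf P(1,4)]) blast
  then have "\<not> bounding P" by (rule not_bounding[OF P(1-3)])
  then show False using bd by blast
qed

section \<open>Unbounded reals\<close>

text \<open>The cone above \<open>p0\<close> is again an atomless ccc forcing notion of size at most
  \<kappa>, so \<open>MA_not_bounding\<close> applies to it; density above its conditions means the
  same in \<open>P\<close>.\<close>

lemma nowhere_bounding:
  fixes \<kappa> :: "'k rel" and P :: "'p rel"
  assumes \<kappa>: "Card_order \<kappa>" "\<kappa> \<le>o |UNIV :: 'u set|"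
    and MA: "MA_ccc_almost_bounding TYPE('u) \<kappa>"
    and P: "forcing_notion P" "atomless P" "ccc P" "|Field P| \<le>o \<kappa>" and p0: "p0 \<in> Field P"
  shows "\<exists>p. (p0, p) \<in> P \<and> \<not> bounding_at P p"
proof -
  define Q where "Q = {(a, b). (a, b) \<in> P \<and> (p0, a) \<in> P}"
  note trans = forcing_notion_trans[OF P(1)]
  have Q_iff: "(a, b) \<in> Q \<longleftrightarrow> (a, b) \<in> P" if "(p0, a) \<in> P" for a b using that by (simp add: Q_def)
  have F: "Field Q = {a. (p0, a) \<in> P}"
  proof
    show "Field Q \<subseteq> {a. (p0, a) \<in> P}" using trans by (auto simp: Q_def Field_def)
    show "{a. (p0, a) \<in> P} \<subseteq> Field Q"
      using forcing_notion_refl[OF P(1) FieldI2] by (auto simp: Q_def intro: FieldI1)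
  qed
  have sub: "Field Q \<subseteq> Field P" unfolding F by (auto intro: FieldI2)
  have Q: "forcing_notion Q"
  proof (rule forcing_notionI)
    show "(p, p) \<in> Q" if "p \<in> Field Q" for p
      using that forcing_notion_refl[OF P(1) FieldI2] by (auto simp: F Q_iff)
    show "(p, s) \<in> Q" if "(p, q) \<in> Q" "(q, s) \<in> Q" for p q s
      using that trans by (auto simp: Q_def)
    show "Field Q \<noteq> {}" using forcing_notion_refl[OF P(1) p0] by (auto simp: F)
  qed
  have compat: "compatible Q a b \<longleftrightarrow> compatible P a b" if "(p0, a) \<in> P" "(p0, b) \<in> P" for a b
    using that by (simp add: compatible_def Q_iff)
  have "atomless Q"
    unfolding atomless_def
  proof
    fix p assume "p \<in> Field Q"
    then have p: "(p0, p) \<in> P" by (simp add: F)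
    then obtain q s where qs: "(p, q) \<in> P" "(p, s) \<in> P" "\<not> compatible P q s"
      using P(2) FieldI2[OF p] by (auto simp: atomless_def)
    then show "\<exists>q s. (p, q) \<in> Q \<and> (p, s) \<in> Q \<and> \<not> compatible Q q s"
      using compat[OF trans[OF p qs(1)] trans[OF p qs(2)]] Q_iff[OF p] by blast
  qed
  moreover have "ccc Q"
    unfolding ccc_def
  proof (intro allI impI)
    fix A assume A: "antichain Q A"
    then have "A \<subseteq> Field P" using sub by (auto simp: antichain_def)
    moreover have "\<not> compatible P p q" if pq: "p \<in> A" "q \<in> A" "p \<noteq> q" for p q
    proof -
      have *: "(p0, p) \<in> P" "(p0, q) \<in> P" using A pq by (auto simp: antichain_def F)
      show ?thesis using A pq compat[OF *] unfolding antichain_def by blast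
    qed
    ultimately have "antichain P A" by (auto simp: antichain_def)
    then show "countable A" by (rule ccc_countable[OF P(3)])
  qed
  moreover have "|Field Q| \<le>o \<kappa>" by (rule ordLeq_transitive[OF card_of_mono1[OF sub] P(4)])
  ultimately have "\<not> bounding Q" using MA_not_bounding[OF \<kappa> MA Q] by blast
  then obtain p where p: "(p0, p) \<in> P" "\<not> bounding_at Q p" by (auto simp: bounding_def F)
  have dense: "dense_above Q q D \<longleftrightarrow> dense_above P q D" if "(p0, q) \<in> P" for q D
  proof -
    have "(q, s) \<in> Q \<longleftrightarrow> (q, s) \<in> P" for s by (rule Q_iff[OF that])
    moreover have "(s, t) \<in> Q \<longleftrightarrow> (s, t) \<in> P" if "(q, s) \<in> P" for s t
      by (rule Q_iff[OF trans[OF \<open>(p0, q) \<in> P\<close> that]])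
    ultimately show ?thesis by (simp add: dense_above_def)
  qed
  have "bounding_at Q p" if bd: "bounding_at P p"
    unfolding bounding_at_def
  proof (intro allI impI)
    fix b assume b: "total_system Q p b"
    have "total_system P p b"
      unfolding total_system_def
    proof (intro conjI allI)
      fix n v
      have op: "open_in Q (b n v)" by (rule total_systemD(1)[OF b])
      then have F_b: "b n v \<subseteq> Field Q" by (simp add: open_in_def)
      have "y \<in> b n v" if "x \<in> b n v" "(x, y) \<in> P" for x y
        using open_inD[OF op that(1), of y] Q_iff[of x y] F_b that by (auto simp: F)
      then show "open_in P (b n v)" using F_b sub by (auto simp: open_in_def)
      show "dense_above P p (\<Union>v. b n v)"
        using b dense[OF p(1)] by (simp add: total_system_def)
    qed
    then obtain q g where q: "(p, q) \<in> P" "\<And>n. dense_above P q (\<Union>v\<le>g n. b n v)"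
      using bd[unfolded bounding_at_def, rule_format, of b] by auto
    then show "\<exists>q g. (p, q) \<in> Q \<and> (\<forall>n. dense_above Q q (\<Union>v\<le>g n. b n v))"
      using dense[OF trans[OF p(1) q(1)]] Q_iff[OF p(1)] by blast
  qed
  then show ?thesis using p by blast
qed

text \<open>Systems witnessing the failure of bounding are glued along a maximal antichain, and
  passing to least elements turns the glued sequence of sets into a function. If \<open>q\<close>
  left only finitely many values at each \<open>n\<close>, some extension of it would bound one of
  the glued systems.\<close>

lemma unbounded_name:
  assumes P: "forcing_notion P" and nb: "\<And>p. p \<in> Field P \<Longrightarrow> \<exists>q. (p, q) \<in> P \<and> \<not> bounding_at P q"
  obtains c :: "nat \<Rightarrow> nat \<Rightarrow> 'p set" where "\<And>n v. open_in P (c n v)"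
    "\<And>n v w x. x \<in> c n v \<Longrightarrow> x \<in> c n w \<Longrightarrow> v = w"
    "\<And>n q. q \<in> Field P \<Longrightarrow> \<exists>v. \<exists>s\<in>c n v. (q, s) \<in> P"
    "\<And>q. q \<in> Field P \<Longrightarrow> \<exists>n. infinite {v. \<exists>s\<in>c n v. (q, s) \<in> P}"
proof -
  note trans = forcing_notion_trans[OF P]
  define U where "U = {p \<in> Field P. \<not> bounding_at P p}"
  obtain A where A: "A \<subseteq> U" "maximal_antichain P A" "\<And>p. p \<in> Field P \<Longrightarrow> \<exists>a\<in>A. compatible P a p"
  proof (rule dense_contains_maximal_antichain[OF P, of U])
    show "\<exists>s\<in>U. (p, s) \<in> P" if "p \<in> Field P" for p
      using nb[OF that] unfolding U_def by (blast intro: FieldI2)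
  qed (auto simp: U_def)
  have anti: "a = a'" if "a \<in> A" "a' \<in> A" "(a, x) \<in> P" "(a', x) \<in> P" for a a' x
    using A(2) that unfolding maximal_antichain_def antichain_def compatible_def by blast
  have "\<forall>a\<in>A. \<exists>b. total_system P a b \<and> (\<forall>q g. (a, q) \<in> P \<longrightarrow> (\<exists>n. \<not> dense_above P q (\<Union>v\<le>g n. b n v)))"
    using A(1) by (auto simp: U_def bounding_at_def)
  then obtain b where b: "\<forall>a\<in>A. total_system P a (b a) \<and>
      (\<forall>q g. (a, q) \<in> P \<longrightarrow> (\<exists>n. \<not> dense_above P q (\<Union>v\<le>g n. b a n v)))"
    by (rule bchoice[THEN exE])
  define d where "d n v = {x. \<exists>a\<in>A. (a, x) \<in> P \<and> x \<in> b a n v}" for n v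
  \<comment> \<open>A condition in \<open>c n v\<close> forces \<open>v\<close> to be the least
    element of the \<open>n\<close>-th set.\<close>
  define c where "c n v = {x \<in> d n v. \<forall>y u. (x, y) \<in> P \<and> u < v \<longrightarrow> y \<notin> d n u}" for n v
  have d_open: "y \<in> d n v" if xy: "x \<in> d n v" "(x, y) \<in> P" for x y n v
  proof -
    obtain a where a: "a \<in> A" "(a, x) \<in> P" "x \<in> b a n v" using xy(1) by (auto simp: d_def)
    then have "open_in P (b a n v)" using b by (simp add: total_system_def)
    then have "y \<in> b a n v" using a(3) xy(2) by (rule open_inD)
    then show ?thesis using a(1) trans[OF a(2) xy(2)] by (auto simp: d_def)
  qed
  have c_dense: "\<exists>v. \<exists>s\<in>c n v. (q, s) \<in> P" if q: "q \<in> Field P" for n q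
  proof -
    obtain a t where a: "a \<in> A" "(a, t) \<in> P" "(q, t) \<in> P" using A(3)[OF q] by (auto simp: compatible_def)
    have "total_system P a (b a)" using b a(1) by blast
    then obtain v s where vs: "s \<in> b a n v" "(t, s) \<in> P" using total_systemD(2)[OF _ a(2)] by blast
    then have ex: "\<exists>s\<in>d n v. (q, s) \<in> P" using trans[OF a(3) vs(2)] trans[OF a(2) vs(2)] a(1)
      by (auto simp: d_def)
    define w where "w = (LEAST v. \<exists>s\<in>d n v. (q, s) \<in> P)"
    obtain x where x: "x \<in> d n w" "(q, x) \<in> P"
      using LeastI[of "\<lambda>v. \<exists>s\<in>d n v. (q, s) \<in> P", OF ex] unfolding w_def by blast
    have "y \<notin> d n u" if "(x, y) \<in> P" "u < w" for y u
      using not_less_Least[of u "\<lambda>v. \<exists>s\<in>d n v. (q, s) \<in> P"] that trans[OF x(2)] unfolding w_def by blast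
    then have "x \<in> c n w" using x(1) by (simp add: c_def)
    then show ?thesis using x(2) by blast
  qed
  show ?thesis
  proof (rule that)
    fix n v
    have "d n v \<subseteq> Field P" by (auto simp: d_def intro: FieldI2)
    then show "open_in P (c n v)"
      unfolding open_in_def c_def using d_open trans by blast
  next
    fix n v w x assume x: "x \<in> c n v" "x \<in> c n w"
    have "x \<in> Field P" using x by (auto simp: c_def d_def intro: FieldI2)
    then have "(x, x) \<in> P" by (rule forcing_notion_refl[OF P])
    then show "v = w" using x unfolding c_def by (metis (no_types, lifting) linorder_neqE_nat mem_Collect_eq)
  next
    fix q assume q: "q \<in> Field P"
    show "\<exists>n. infinite {v. \<exists>s\<in>c n v. (q, s) \<in> P}"
    proof (rule ccontr)
      assume "\<nexists>n. infinite {v. \<exists>s\<in>c n v. (q, s) \<in> P}"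
      then have "\<forall>n. \<exists>m. \<forall>v\<in>{v. \<exists>s\<in>c n v. (q, s) \<in> P}. v \<le> m"
        using finite_nat_set_iff_bounded_le by blast
      then obtain g where "\<forall>n. \<forall>v\<in>{v. \<exists>s\<in>c n v. (q, s) \<in> P}. v \<le> g n"
        by (rule choice[THEN exE])
      then have g: "v \<le> g n" if "s \<in> c n v" "(q, s) \<in> P" for n v s using that by blast
      \<comment> \<open>Above the common extension \<open>t\<close>, the values of \<open>c\<close>
        come from the system of \<open>a\<close> by incompatibility in \<open>A\<close>, and they
        obey \<open>g\<close> because \<open>t\<close> extends \<open>q\<close>.\<close>
      obtain a t where a: "a \<in> A" "(a, t) \<in> P" "(q, t) \<in> P" using A(3)[OF q] by (auto simp: compatible_def)
      then obtain n where n: "\<not> dense_above P t (\<Union>v\<le>g n. b a n v)" using b by blast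
      have "dense_above P t (\<Union>v\<le>g n. b a n v)"
        unfolding dense_above_def
      proof (intro allI impI)
        fix y assume y: "(t, y) \<in> P"
        obtain v s where s: "s \<in> c n v" "(y, s) \<in> P" using c_dense[OF FieldI2[OF y]] by blast
        have as: "(a, s) \<in> P" "(q, s) \<in> P" using trans[OF _ trans[OF y s(2)]] a by blast+
        obtain a' where a': "a' \<in> A" "(a', s) \<in> P" "s \<in> b a' n v" using s(1) by (auto simp: c_def d_def)
        have "a' = a" by (rule anti[OF a'(1) a(1) a'(2) as(1)])
        then show "\<exists>s\<in>\<Union>v\<le>g n. b a n v. (y, s) \<in> P" using a'(3) g[OF s(1) as(2)] s(2) by blast
      qed
      then show False using n by blast
    qed
  qed (rule c_dense)
qed

section \<open>From unbounded reals to Cohen reals\<close>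

definition prefix_rel :: "'a list rel" where
  "prefix_rel = {(x, y). prefix x y}"

lemma prefix_rel_iff [simp]: "(x, y) \<in> prefix_rel \<longleftrightarrow> prefix x y"
  by (simp add: prefix_rel_def)

lemma Field_prefix_rel [simp]: "Field prefix_rel = UNIV"
  by (auto simp: prefix_rel_def Field_def)

lemma MA_prefix_rel:
  fixes \<kappa> :: "'k rel"
  assumes \<kappa>: "Card_order \<kappa>" "infinite (Field \<kappa>)" "\<kappa> \<le>o |UNIV :: 'u set|"
    and MA: "MA_ccc_almost_bounding TYPE('u) \<kappa>"
  shows "MA \<kappa> (prefix_rel :: 'a::countable list rel)"
proof (rule MA_transfer[OF MA])
  have "|UNIV :: 'a list set| \<le>o natLeq" by (rule countable_card_le_natLeq[THEN iffD1]) simp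
  moreover have "natLeq \<le>o \<kappa>" by (rule natLeq_ordLeq_cinfinite) (use \<kappa> in \<open>simp add: cinfinite_def\<close>)
  ultimately show "|Field (prefix_rel :: 'a list rel)| \<le>o |UNIV :: 'u set|"
    using \<kappa>(3) by (auto intro: ordLeq_transitive)
  show fn: "forcing_notion (prefix_rel :: 'a list rel)" by (rule forcing_notionI) auto
  show "ccc (prefix_rel :: 'a list rel)" by (simp add: ccc_def)
  show "strongly_almost_bounding (prefix_rel :: 'a list rel)"
    by (rule countable_strongly_almost_bounding[OF fn]) simp
qed

text \<open>Any finite sequence can be prolonged so that \<open>t i\<close> occurs at a later
  position in the infinite set \<open>K i\<close>. The members of a filter agree on common
  positions, so their entries define \<open>h\<close>.\<close>

lemma MA_generic_sequence:
  fixes \<kappa> :: "'k rel" and K :: "'i \<Rightarrow> nat set" and t :: "'i \<Rightarrow> 'a"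
  assumes \<kappa>: "Card_order \<kappa>" and MA: "MA \<kappa> (prefix_rel :: 'a list rel)"
    and I: "|I| \<le>o \<kappa>" "\<And>i. i \<in> I \<Longrightarrow> infinite (K i)"
  obtains h :: "nat \<Rightarrow> 'a" where "\<And>i. i \<in> I \<Longrightarrow> \<exists>k\<in>K i. h k = t i"
proof -
  define D where "D i = {c. \<exists>k\<in>K i. k < length c \<and> c ! k = t i}" for i
  have fn: "forcing_notion (prefix_rel :: 'a list rel)" by (rule forcing_notionI) auto
  have dense: "dense_above prefix_rel [] (D i)" if i: "i \<in> I" for i
    unfolding dense_above_def
  proof (intro allI impI)
    fix c :: "'a list"
    obtain k where k: "k \<in> K i" "length c \<le> k" using I(2)[OF i] by (meson infinite_nat_iff_unbounded_le)
    \<comment> \<open>The padding ends exactly at position \<open>k\<close>.\<close>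
    have "c @ replicate (Suc k - length c) (t i) \<in> D i"
      using k by (auto simp: D_def nth_append intro!: bexI[of _ k])
    then show "\<exists>s\<in>D i. (c, s) \<in> prefix_rel" by (metis prefixI prefix_rel_iff)
  qed
  obtain G where G: "forcing_filter (prefix_rel :: 'a list rel) G" "\<And>i. i \<in> I \<Longrightarrow> G \<inter> D i \<noteq> {}"
    by (rule MA_dense[OF MA fn \<kappa> I(1), of "[]" D]) (use dense in auto)
  have eq: "c ! k = d ! k" if c: "c \<in> G" "d \<in> G" "k < length c" "k < length d" for c d k
  proof -
    obtain e where "prefix c e" "prefix d e" using filter_directed[OF G(1) c(1,2)] by auto
    then show ?thesis using c by (auto simp: prefix_def nth_append) (metis nth_append)
  qed
  define h where "h k = (SOME x. \<exists>c\<in>G. k < length c \<and> x = c ! k)" for k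
  have h: "h k = c ! k" if c: "c \<in> G" "k < length c" for c k
  proof -
    have "\<exists>d\<in>G. k < length d \<and> h k = d ! k"
      unfolding h_def by (rule someI[of _ "c ! k"]) (use c in blast)
    then obtain d where d: "d \<in> G" "k < length d" "h k = d ! k" by blast
    then show ?thesis using eq[OF d(1) c(1) d(2) c(2)] by simp
  qed
  show ?thesis
  proof (rule that)
    fix i assume "i \<in> I"
    then obtain c k where "c \<in> G" "k \<in> K i" "k < length c" "c ! k = t i"
      using G(2) unfolding D_def by blast
    then show "\<exists>k\<in>K i. h k = t i" using h[of c k] by (intro bexI[of _ k]) simp_all
  qed
qed

text \<open>The conditions deciding that the function named by \<open>c\<close> begins with
  \<open>\<sigma>\<close>.\<close>

definition cylinder :: "'p rel \<Rightarrow> (nat \<Rightarrow> nat \<Rightarrow> 'p set) \<Rightarrow> nat list \<Rightarrow> 'p set" where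
  "cylinder P c \<sigma> = {s \<in> Field P. \<forall>i<length \<sigma>. s \<in> c i (\<sigma> ! i)}"

text \<open>The part of \<open>h(0, x(0)) h(1, x(1)) ...\<close> determined by the initial segment
  \<open>\<sigma>\<close> of \<open>x\<close>.\<close>

definition blocks :: "(nat \<Rightarrow> nat \<Rightarrow> 'a list) \<Rightarrow> nat list \<Rightarrow> 'a list" where
  "blocks h \<sigma> = concat (map (\<lambda>i. h i (\<sigma> ! i)) [0..<length \<sigma>])"

lemma cylinder_snoc: "cylinder P c (\<sigma> @ [k]) = cylinder P c \<sigma> \<inter> c (length \<sigma>) k"
  by (auto simp: cylinder_def nth_append less_Suc_eq)

lemma blocks_snoc: "blocks h (\<sigma> @ [k]) = blocks h \<sigma> @ h (length \<sigma>) k"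
proof -
  have "map (\<lambda>i. h i ((\<sigma> @ [k]) ! i)) [0..<length \<sigma>] = map (\<lambda>i. h i (\<sigma> ! i)) [0..<length \<sigma>]"
    by (auto simp: nth_append)
  then show ?thesis by (simp add: blocks_def del: map_eq_conv)
qed

lemma prefix_blocks: "prefix (blocks h \<sigma>) (blocks h (\<sigma> @ \<tau>))"
proof (induction \<tau> rule: rev_induct)
  case (snoc k \<tau>)
  then show ?case by (metis append.assoc blocks_snoc prefix_prefix)
qed simp

lemma length_blocks:
  assumes "\<And>n k. h n k \<noteq> []"
  shows "length \<sigma> \<le> length (blocks h \<sigma>)"
proof (induction \<sigma> rule: rev_induct)
  case (snoc k \<sigma>)
  have "0 < length (h (length \<sigma>) k)" using assms by simp
  moreover have "length (\<sigma> @ [k]) = length \<sigma> + 1" by simp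
  ultimately show ?case using snoc unfolding blocks_snoc length_append by linarith
qed simp

text \<open>If every \<open>\<sigma>\<close> had only finitely many successors possible over
  \<open>q\<close>, there would be only finitely many possible sequences of each length, hence only
  finitely many values at \<open>n\<close>.\<close>

lemma cylinder_infinite_splitting:
  assumes P: "forcing_notion P" and op: "\<And>n v. open_in P (c n v)"
    and disj: "\<And>n v w x. x \<in> c n v \<Longrightarrow> x \<in> c n w \<Longrightarrow> v = w"
    and cyl_dense: "\<And>n q. q \<in> Field P \<Longrightarrow> \<exists>s \<sigma>. (q, s) \<in> P \<and> length \<sigma> = n \<and> s \<in> cylinder P c \<sigma>"
    and unb: "infinite {v. \<exists>s\<in>c n v. (q, s) \<in> P}"
  obtains \<sigma> where "infinite {k. \<exists>s\<in>cylinder P c (\<sigma> @ [k]). (q, s) \<in> P}"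
proof (rule ccontr)
  assume no: "\<not> thesis"
  define S where "S m = {\<sigma>. length \<sigma> = m \<and> (\<exists>s\<in>cylinder P c \<sigma>. (q, s) \<in> P)}" for m
  have fin: "finite (S m)" for m
  proof (induction m)
    case 0
    have "S 0 \<subseteq> {[]}" by (auto simp: S_def)
    then show ?case by (rule finite_subset) simp
  next
    case (Suc m)
    have "S (Suc m) \<subseteq> (\<Union>\<sigma>\<in>S m. (\<lambda>k. \<sigma> @ [k]) ` {k. \<exists>s\<in>cylinder P c (\<sigma> @ [k]). (q, s) \<in> P})"
    proof
      fix \<tau> assume \<tau>: "\<tau> \<in> S (Suc m)"
      then have "length \<tau> = Suc m" by (simp add: S_def)
      then obtain \<sigma> k where \<sigma>: "\<tau> = \<sigma> @ [k]" "length \<sigma> = m" by (metis length_Suc_conv_rev)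
      then show "\<tau> \<in> (\<Union>\<sigma>\<in>S m. (\<lambda>k. \<sigma> @ [k]) ` {k. \<exists>s\<in>cylinder P c (\<sigma> @ [k]). (q, s) \<in> P})"
        using \<tau> by (auto simp: S_def cylinder_snoc)
    qed
    moreover have "finite {k. \<exists>s\<in>cylinder P c (\<sigma> @ [k]). (q, s) \<in> P}" for \<sigma>
      using no that by blast
    ultimately show ?case using Suc by (meson finite_UN_I finite_imageI finite_subset)
  qed
  have "{v. \<exists>s\<in>c n v. (q, s) \<in> P} \<subseteq> (\<lambda>\<sigma>. \<sigma> ! n) ` S (Suc n)"
  proof
    fix v assume "v \<in> {v. \<exists>s\<in>c n v. (q, s) \<in> P}"
    then obtain s where s: "s \<in> c n v" "(q, s) \<in> P" by blast
    obtain t \<sigma> where t: "(s, t) \<in> P" "length \<sigma> = Suc n" "t \<in> cylinder P c \<sigma>"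
      using cyl_dense[OF FieldI2[OF s(2)]] by blast
    have "t \<in> c n v" by (rule open_inD[OF op s(1) t(1)])
    moreover have "t \<in> c n (\<sigma> ! n)" using t(2,3) by (simp add: cylinder_def)
    ultimately have "v = \<sigma> ! n" by (rule disj)
    moreover have "\<sigma> \<in> S (Suc n)" using t forcing_notion_trans[OF P s(2) t(1)] by (auto simp: S_def)
    ultimately show "v \<in> (\<lambda>\<sigma>. \<sigma> ! n) ` S (Suc n)" by blast
  qed
  then show False using unb fin finite_subset by blast
qed

text \<open>Given a dense set \<open>D\<close>, the part of the real determined by a suitable
  \<open>\<sigma>\<close> is prolonged to an element of \<open>D\<close>. Infinitely many next
  values are possible after \<open>\<sigma>\<close>, and by \<open>gen\<close> one of them has the
  missing piece as its block.\<close>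

lemma unbounded_adds_Cohen_real:
  fixes P :: "'p rel" and h :: "nat \<Rightarrow> nat \<Rightarrow> bool list"
  assumes P: "forcing_notion P" and op: "\<And>n v. open_in P (c n v)"
    and disj: "\<And>n v w x. x \<in> c n v \<Longrightarrow> x \<in> c n w \<Longrightarrow> v = w"
    and dense: "\<And>n q. q \<in> Field P \<Longrightarrow> \<exists>v. \<exists>s\<in>c n v. (q, s) \<in> P"
    and unb: "\<And>q. q \<in> Field P \<Longrightarrow> \<exists>n. infinite {v. \<exists>s\<in>c n v. (q, s) \<in> P}"
    and h: "\<And>n k. h n k \<noteq> []"
    and gen: "\<And>q \<sigma> t. q \<in> Field P \<Longrightarrow> infinite {k. \<exists>s\<in>cylinder P c (\<sigma> @ [k]). (q, s) \<in> P} \<Longrightarrow> t \<noteq> [] \<Longrightarrow>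
      \<exists>k. (\<exists>s\<in>cylinder P c (\<sigma> @ [k]). (q, s) \<in> P) \<and> h (length \<sigma>) k = t"
  shows "adds_Cohen_real P"
proof -
  note trans = forcing_notion_trans[OF P] and refl = forcing_notion_refl[OF P]
  let ?C = "cylinder P c"
  note [simp] = forces_def f_all_def f_ex_def f_and_def f_val_def f_not_def
  have cyl_open: "t \<in> ?C \<sigma>" if "s \<in> ?C \<sigma>" "(s, t) \<in> P" for s t \<sigma>
    using that(1) open_inD[OF op _ that(2)] FieldI2[OF that(2)] by (simp add: cylinder_def)
  have cyl_dense: "\<exists>s \<sigma>. (q, s) \<in> P \<and> length \<sigma> = n \<and> s \<in> ?C \<sigma>" if q: "q \<in> Field P" for n q
  proof (induction n)
    case 0
    show ?case
      by (intro exI[of _ q] exI[of _ "[]"]) (use q refl in \<open>simp add: cylinder_def\<close>)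
  next
    case (Suc n)
    then obtain s \<sigma> where s: "(q, s) \<in> P" "length \<sigma> = n" "s \<in> ?C \<sigma>" by blast
    obtain v t where t: "t \<in> c n v" "(s, t) \<in> P" using dense[OF FieldI2[OF s(1)]] by blast
    have "t \<in> ?C (\<sigma> @ [v])" using cyl_open[OF s(3) t(2)] t(1) s(2) by (simp add: cylinder_snoc)
    then show ?case using trans[OF s(1) t(2)] s(2) by (metis length_append_singleton)
  qed
  have cyl_prefix: "\<exists>\<rho>. \<tau> = \<sigma> @ \<rho>" if s: "s \<in> ?C \<sigma>" "s \<in> ?C \<tau>" "length \<sigma> \<le> length \<tau>" for s \<sigma> \<tau>
  proof -
    have "\<sigma> = take (length \<sigma>) \<tau>"
      by (rule nth_equalityI) (use s disj in \<open>auto simp: cylinder_def\<close>)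
    then show ?thesis by (metis append_take_drop_id)
  qed
  have blocks_eq: "blocks h \<sigma> ! i = blocks h \<tau> ! i"
    if s: "s \<in> ?C \<sigma>" "s \<in> ?C \<tau>" and i: "i < length (blocks h \<sigma>)" "i < length (blocks h \<tau>)" for s \<sigma> \<tau> i
  proof -
    have "prefix (blocks h \<sigma>) (blocks h \<tau>) \<or> prefix (blocks h \<tau>) (blocks h \<sigma>)"
      using cyl_prefix[OF s] cyl_prefix[OF s(2,1)] prefix_blocks by (metis nat_le_linear)
    then show ?thesis using i by (auto simp: prefix_def nth_append)
  qed
  \<comment> \<open>The name of the concatenated real: digit \<open>i\<close> is read off any
    cylinder whose blocks are long enough, and by \<open>blocks_eq\<close> the result does not
    depend on the cylinder.\<close>
  define f where "f i v = {s. \<exists>\<sigma>. s \<in> ?C \<sigma> \<and> i < length (blocks h \<sigma>) \<and> blocks h \<sigma> ! i = v}" for i v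
  have f_meets: "f_meets (f i v) P s" if s: "s \<in> ?C \<sigma>" "i < length (blocks h \<sigma>)" "blocks h \<sigma> ! i = v"
    for i v s \<sigma>
    unfolding f_meets_def
  proof (intro allI impI)
    fix q assume q: "(s, q) \<in> P"
    have "q \<in> f i v" using cyl_open[OF s(1) q] s(2,3) by (auto simp: f_def)
    then show "\<exists>sa. (q, sa) \<in> P \<and> (\<exists>a\<in>f i v. (a, sa) \<in> P)" using refl[OF FieldI2[OF q]] by blast
  qed
  have f_unique: "\<not> f_meets (f i w) P s"
    if s: "s \<in> ?C \<sigma>" "i < length (blocks h \<sigma>)" "blocks h \<sigma> ! i \<noteq> w" for i w s \<sigma>
  proof
    assume "f_meets (f i w) P s"
    moreover have "(s, s) \<in> P" using refl s(1) by (simp add: cylinder_def)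
    ultimately obtain t a where t: "(s, t) \<in> P" "a \<in> f i w" "(a, t) \<in> P" unfolding f_meets_def by blast
    then obtain \<tau> where \<tau>: "a \<in> ?C \<tau>" "i < length (blocks h \<tau>)" "blocks h \<tau> ! i = w" by (auto simp: f_def)
    show False
      using blocks_eq[OF cyl_open[OF s(1) t(1)] cyl_open[OF \<tau>(1) t(3)] s(2) \<tau>(2)] s(3) \<tau>(3) by simp
  qed
  have "function_name P f"
    unfolding function_name_def
  proof (intro conjI allI ballI)
    fix i v show "f i v \<subseteq> Field P" by (auto simp: f_def cylinder_def)
  next
    fix p assume "p \<in> Field P"
    have "\<exists>s. (q, s) \<in> P \<and> (\<exists>v. f_meets (f i v) P s \<and>
        (\<forall>w\<in>- {v}. \<forall>t. (s, t) \<in> P \<longrightarrow> \<not> f_meets (f i w) P t))" if q: "(p, q) \<in> P" for q i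
    proof -
      obtain s \<sigma> where s: "(q, s) \<in> P" "length \<sigma> = Suc i" "s \<in> ?C \<sigma>"
        using cyl_dense[OF FieldI2[OF q]] by blast
      \<comment> \<open>Blocks are nonempty, so the first \<open>Suc i\<close> of them reach digit
        \<open>i\<close>.\<close>
      have i: "i < length (blocks h \<sigma>)" using length_blocks[of h \<sigma>] h s(2) by simp
      have "\<not> f_meets (f i w) P t" if "w \<noteq> blocks h \<sigma> ! i" "(s, t) \<in> P" for w t
        using f_unique[OF cyl_open[OF s(3) that(2)] i] that(1) by blast
      then show ?thesis using s(1) f_meets[OF s(3) i] by blast
    qed
    then show "forces P p (f_all UNIV (\<lambda>n. f_ex UNIV (\<lambda>v.
           f_and (f_val f n v) (f_all (- {v}) (\<lambda>w. f_not (f_val f n w))))))" by simp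
  qed
  moreover have "forces P p (f_Cohen f)" if "p \<in> Field P" for p
  proof -
    have "\<exists>s. (q, s) \<in> P \<and> (\<exists>t\<in>D. \<forall>i<length t. f_meets (f i (t ! i)) P s)"
      if D: "Cohen_dense D" and q: "(p, q) \<in> P" for D q
    proof -
      have qF: "q \<in> Field P" using q by (rule FieldI2)
      obtain n where n: "infinite {v. \<exists>s\<in>c n v. (q, s) \<in> P}" using unb[OF qF] by blast
      obtain \<sigma> where \<sigma>: "infinite {k. \<exists>s\<in>?C (\<sigma> @ [k]). (q, s) \<in> P}"
        by (rule cylinder_infinite_splitting[OF P op disj cyl_dense n])
      \<comment> \<open>The extra digit makes the missing piece \<open>u\<close> nonempty, as
        \<open>gen\<close> requires.\<close>
      obtain t where t: "t \<in> D" "prefix (blocks h \<sigma> @ [True]) t"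
        using D by (auto simp: Cohen_dense_def)
      then obtain u where u: "t = blocks h \<sigma> @ u" "u \<noteq> []" by (auto simp: prefix_def)
      obtain k s where s: "s \<in> ?C (\<sigma> @ [k])" "(q, s) \<in> P" "h (length \<sigma>) k = u"
        using gen[OF qF \<sigma> u(2)] by blast
      have "blocks h (\<sigma> @ [k]) = t" using s(3) u(1) by (simp add: blocks_snoc)
      then have "\<forall>i<length t. f_meets (f i (t ! i)) P s" using f_meets[OF s(1)] by simp
      then show ?thesis using t(1) s(2) by blast
    qed
    then show ?thesis by (simp add: f_Cohen_def)
  qed
  ultimately show ?thesis unfolding adds_Cohen_real_def by blast
qed

theorem theorem1p9:
  fixes \<kappa> :: "'k rel" and P :: "'p rel"
  assumes "Card_order \<kappa>"
    and "\<kappa> ^c natLeq \<le>o |UNIV :: 'u set|"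
    and "MA_ccc_almost_bounding TYPE('u) \<kappa>"
    and "forcing_notion P" and "atomless P" and "ccc P" and "|Field P| \<le>o \<kappa>"
  shows "adds_Cohen_real P"
proof -
  \<comment> \<open>\<open>\<kappa>\<close> is at most its power \<open>\<kappa> ^c natLeq\<close>,
    so forcing notions of size at most \<kappa> have copies with conditions in
    \<open>'u\<close>.\<close>
  have u: "\<kappa> \<le>o |UNIV :: 'u set|"
    by (rule ordLeq_transitive[OF ordLeq_cexp1[OF Cinfinite_Cnotzero[OF natLeq_Cinfinite] assms(1)] assms(2)])
  have inf: "infinite (Field \<kappa>)" by (rule infinite_Field_cardinal[OF assms(1,4,5,7)])
  have nb: "\<exists>q. (p, q) \<in> P \<and> \<not> bounding_at P q" if "p \<in> Field P" for p
    by (rule nowhere_bounding[OF assms(1) u assms(3-7) that])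
  show ?thesis
  proof (rule unbounded_name[OF assms(4) nb])
    fix c :: "nat \<Rightarrow> nat \<Rightarrow> 'p set"
    assume c: "\<And>n v. open_in P (c n v)"
      "\<And>n v w x. x \<in> c n v \<Longrightarrow> x \<in> c n w \<Longrightarrow> v = w"
      "\<And>n q. q \<in> Field P \<Longrightarrow> \<exists>v. \<exists>s\<in>c n v. (q, s) \<in> P"
      "\<And>q. q \<in> Field P \<Longrightarrow> \<exists>n. infinite {v. \<exists>s\<in>c n v. (q, s) \<in> P}"
    \<comment> \<open>A single generic sequence \<open>h0\<close> over a countable alphabet is to
      yield \<open>h\<close>: arguments are coded by \<open>prod_encode\<close>, and nonempty blocks
      by a first digit and a rest. \<open>K\<close> collects the coded positions at which the block
      \<open>t\<close> would be useful for \<open>q\<close> and \<open>\<sigma>\<close>; only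
      triples with infinitely many of them enter \<open>I\<close>.\<close>
    define K where "K = (\<lambda>(q, \<sigma>, t :: bool \<times> bool list).
      {prod_encode (length \<sigma>, k) | k. \<exists>s\<in>cylinder P c (\<sigma> @ [k]). (q, s) \<in> P})"
    define I where "I = {i \<in> Field P \<times> UNIV. infinite (K i)}"
    have "|UNIV :: (nat list \<times> bool \<times> bool list) set| \<le>o natLeq"
      by (rule countable_card_le_natLeq[THEN iffD1]) simp
    moreover have "natLeq \<le>o \<kappa>"
      by (rule natLeq_ordLeq_cinfinite) (use assms(1) inf in \<open>simp add: cinfinite_def\<close>)
    ultimately have "|UNIV :: (nat list \<times> bool \<times> bool list) set| \<le>o \<kappa>" by (rule ordLeq_transitive)
    then have *: "|Field P \<times> (UNIV :: (nat list \<times> bool \<times> bool list) set)| \<le>o \<kappa>"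
      by (rule card_of_Times_ordLeq_infinite_Field[OF inf assms(7) _ assms(1)])
    have I: "|I| \<le>o \<kappa>"
      by (rule ordLeq_transitive[OF card_of_mono1 *]) (auto simp: I_def)
    obtain h0 :: "nat \<Rightarrow> bool \<times> bool list" where h0: "\<And>i. i \<in> I \<Longrightarrow> \<exists>k\<in>K i. h0 k = snd (snd i)"
      by (rule MA_generic_sequence[OF assms(1) MA_prefix_rel[OF assms(1) inf u assms(3)] I,
            of K "\<lambda>i. snd (snd i)"]) (auto simp: I_def)
    define h where "h n k = (case h0 (prod_encode (n, k)) of (x, xs) \<Rightarrow> x # xs)" for n k
    show "adds_Cohen_real P"
    proof (rule unbounded_adds_Cohen_real[OF assms(4) c])
      show "h n k \<noteq> []" for n k by (simp add: h_def split: prod.split)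
      fix q \<sigma> and t :: "bool list"
      let ?S = "{k. \<exists>s\<in>cylinder P c (\<sigma> @ [k]). (q, s) \<in> P}"
      assume q: "q \<in> Field P" and S: "infinite ?S" and "t \<noteq> []"
      then obtain x xs where t: "t = x # xs" by (cases t) auto
      have "K (q, \<sigma>, (x, xs)) = (\<lambda>k. prod_encode (length \<sigma>, k)) ` ?S" by (auto simp: K_def)
      moreover have "inj_on (\<lambda>k. prod_encode (length \<sigma>, k)) ?S" by (auto simp: inj_on_def)
      ultimately have "infinite (K (q, \<sigma>, (x, xs)))" using S by (simp add: finite_image_iff)
      then have "(q, \<sigma>, (x, xs)) \<in> I" using q by (simp add: I_def)
      then obtain k where "k \<in> ?S" "h0 (prod_encode (length \<sigma>, k)) = (x, xs)"
        using h0 by (force simp: K_def)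
      then show "\<exists>k. (\<exists>s\<in>cylinder P c (\<sigma> @ [k]). (q, s) \<in> P) \<and> h (length \<sigma>) k = t"
        using t by (intro exI[of _ k]) (simp add: h_def)
    qed
  qed
qed

end
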